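(* Let $n$ be a positive integer, let $\beta>0$, let $f_0,\dots,f_n$ be linearly independent functions in $A^{-\beta}$, and put $$\gamma=n\beta+\frac{n(n+1)}{2}.$$ Then $E_\gamma(f_0,\dots,f_n)$ is a set of Lebesgue measure $0$ on $\mathbb{T}$. The same is true for $\beta=0$, provided that $A^{-\beta}$ is replaced by $H^\infty$; that is, if $f_0,\dots,f_n$ are linearly independent functions in $H^\infty$ and $\gamma=\frac{n(n+1)}{2}$, then $E_\gamma(f_0,\dots,f_n)$ has Lebesgue measure $0$ on $\mathbb{T}$.
   Context: $\mathbb{D}=\{z\in\mathbb{C}:|z|<1\}$, $\mathbb{T}=\partial\mathbb{D}$. $H^\infty$ is the space of bounded holomorphic functions on $\mathbb{D}$. For $\beta>0$, $A^{-\beta}$ is the set of all holomorphic $f$ on $\mathbb{D}$ with $\sup_{z\in\mathbb{D}}|f(z)|(1-|z|)^\beta<\infty$. For $\zeta\in\mathbb{T}$ and $M>1$, put $\Gamma_M(\zeta)=\{z\in\mathbb{D}:|\zeta-z|\le M(1-|z|)\}$. For $\gamma>0$, a holomorphic function $f$ on $\mathbb{D}$ is nontangentially small of order $>\gamma$ at $\zeta\in\mathbb{T}$ if, for some $M>1$, $f(z)=o\left((1-|z|)^\gamma\right)$ as $|z|\to1$, $z\in\Gamma_M(\zeta)$. For linearly independent holomorphic functions $f_0,\dots,f_n$ on $\mathbb{D}$, $E_\gamma(f_0,\dots,f_n)$ denotes the set of all $\zeta\in\mathbb{T}$ for which there exist complex numbers $\lambda_0,\dots,\lambda_n$ (depending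 on $\zeta$), not all zero, such that $\sum_{j=0}^n\lambda_jf_j$ is nontangentially small of order $>\gamma$ at $\zeta$. *)

theory Defs
  imports "HOL-Complex_Analysis.Complex_Analysis" "HOL-Library.Landau_Symbols"
begin

abbreviation unit_disc :: "complex set" where
  "unit_disc \<equiv> ball 0 1"

abbreviation unit_circle :: "complex set" where
  "unit_circle \<equiv> sphere 0 1"

definition H_infinity :: "(complex \<Rightarrow> complex) set" where
  "H_infinity = {f. f holomorphic_on unit_disc \<and> bounded (f ` unit_disc)}"

text \<open>The space \<open>A\<^sup>-\<^sup>\<beta>\<close>; the parameter below is \<open>\<beta>\<close>, not \<open>-\<beta>\<close>.\<close>

definition growth_space :: "real \<Rightarrow> (complex \<Rightarrow> complex) set" where
  "growth_space \<beta> = {f. f holomorphic_on unit_disc \<and>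
     bdd_above ((\<lambda>z. norm (f z) * (1 - norm z) powr \<beta>) ` unit_disc)}"

definition nontangential_region :: "real \<Rightarrow> complex \<Rightarrow> complex set" where
  "nontangential_region M \<zeta> = {z \<in> unit_disc. norm (\<zeta> - z) \<le> M * (1 - norm z)}"

text \<open>The filter expresses \<open>|z| \<rightarrow> 1\<close> with \<open>z\<close> restricted to the region.\<close>

definition nontangentially_small :: "real \<Rightarrow> complex \<Rightarrow> (complex \<Rightarrow> complex) \<Rightarrow> bool" where
  "nontangentially_small \<gamma> \<zeta> f \<longleftrightarrow>
     (\<exists>M>1. let F = inf (filtercomap norm (at_left 1)) (principal (nontangential_region M \<zeta>))
            in f \<in> o[F](\<lambda>z. complex_of_real ((1 - norm z) powr \<gamma>)))"

text \<open>Linear independence over the complex numbers of the family \<open>f 0, \<dots>, f n\<close> of functions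
  on the disc. Functions in HOL are total, so their values outside the disc must be ignored.\<close>

definition lin_indep_on_disc :: "nat \<Rightarrow> (nat \<Rightarrow> complex \<Rightarrow> complex) \<Rightarrow> bool" where
  "lin_indep_on_disc n f \<longleftrightarrow>
     (\<forall>c :: nat \<Rightarrow> complex. (\<forall>z\<in>unit_disc. (\<Sum>j\<le>n. c j * f j z) = 0) \<longrightarrow> (\<forall>j\<le>n. c j = 0))"

definition small_set :: "real \<Rightarrow> nat \<Rightarrow> (nat \<Rightarrow> complex \<Rightarrow> complex) \<Rightarrow> complex set" where
  "small_set \<gamma> n f = {\<zeta> \<in> unit_circle. \<exists>c :: nat \<Rightarrow> complex.
     (\<exists>j\<le>n. c j \<noteq> 0) \<and> nontangentially_small \<gamma> \<zeta> (\<lambda>z. \<Sum>j\<le>n. c j * f j z)}"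

text \<open>Arc length as a complete measure on the unit circle.\<close>

definition circle_lebesgue :: "complex measure" where
  "circle_lebesgue =
     completion (distr (restrict_space lborel {0..<2*pi}) (restrict_space borel unit_circle) cis)"

text \<open>In terms of the angle, without the measure on the circle; \<open>E\<close> need not be Borel.\<close>

lemma null_sets_circle_lebesgue_iff:
  assumes "E \<subseteq> unit_circle"
  shows "E \<in> null_sets circle_lebesgue \<longleftrightarrow> negligible {t \<in> {0..<2*pi}. cis t \<in> E}"
proof -
  let ?R = "restrict_space lborel {0..<2*pi}" and ?C = "restrict_space borel unit_circle"
  let ?D = "distr ?R ?C cis"
  have cis_borel: "cis \<in> borel_measurable borel"
    by (intro borel_measurable_continuous_onI continuous_intros)
  have cis_meas: "cis \<in> measurable ?R ?C"
    by (intro measurable_restrict_space3) (use cis_borel in auto)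
  have C_sets: "sets ?C = {A. A \<in> sets borel \<and> A \<subseteq> unit_circle}"
    by (rule set_eqI) (simp add: sets_restrict_space_iff conj_commute)
  have D_null: "N \<in> null_sets ?D \<longleftrightarrow>
      N \<in> sets borel \<and> N \<subseteq> unit_circle \<and> {t \<in> {0..<2*pi}. cis t \<in> N} \<in> null_sets lborel" for N
  proof (cases "N \<in> sets borel \<and> N \<subseteq> unit_circle")
    case True
    have eq: "cis -` N \<inter> space ?R = {t \<in> {0..<2*pi}. cis t \<in> N}"
      by (auto simp: space_restrict_space)
    have "cis -` N \<in> sets borel"
      using measurable_sets[OF cis_borel, of N] True by auto
    hence "{t \<in> {0..<2*pi}. cis t \<in> N} \<in> sets borel"
      using sets.Int[of "cis -` N" borel "{0..<2*pi}"] by (simp add: vimage_def Int_def conj_commute)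
    moreover have "emeasure ?D N = emeasure lborel {t \<in> {0..<2*pi}. cis t \<in> N}"
      using True cis_meas by (subst emeasure_distr)
          (auto simp: C_sets emeasure_restrict_space space_restrict_space intro!: arg_cong[of _ _ "emeasure lborel"])
    ultimately show ?thesis
      using True by (auto simp: null_sets_def C_sets)
  next
    case False
    thus ?thesis by (auto simp: null_sets_def C_sets)
  qed
  show ?thesis
  proof
    assume "E \<in> null_sets circle_lebesgue"
    then obtain N where N: "N \<in> null_sets ?D" "E \<subseteq> N"
      unfolding circle_lebesgue_def null_sets_completion_iff2 by auto
    have "negligible {t \<in> {0..<2*pi}. cis t \<in> N}"
      using N(1) D_null[of N] by (simp add: negligible_iff_null_sets null_sets_completionI)
    thus "negligible {t \<in> {0..<2*pi}. cis t \<in> E}"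
      by (rule negligible_subset) (use N in auto)
  next
    assume "negligible {t \<in> {0..<2*pi}. cis t \<in> E}"
    then obtain P where P: "P \<in> null_sets lborel" "{t \<in> {0..<2*pi}. cis t \<in> E} \<subseteq> P"
      unfolding negligible_iff_null_sets null_sets_completion_iff2 by auto
    define g where "g z = (if Im (Ln z) < 0 then Im (Ln z) + 2*pi else Im (Ln z))" for z
    have "g \<in> borel_measurable borel"
      unfolding g_def by measurable
    hence "g -` P \<in> sets borel"
      using P(1) measurable_sets[of g borel borel P] by auto
    define N where "N = g -` P \<inter> unit_circle"
    have N: "N \<in> sets borel" "N \<subseteq> unit_circle"
      using \<open>g -` P \<in> sets borel\<close> by (auto simp: N_def)
    have g_range: "g z \<in> {0..<2*pi}" and cis_g: "cis (g z) = z" if "norm z = 1" for z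
    proof -
      have z: "z \<noteq> 0" using that by auto
      have "exp (Ln z) = z" using z by simp
      hence c: "cis (Im (Ln z)) = z"
        using that z by (simp add: cis_conv_exp exp_eq_polar[of "Ln z"])
      show "g z \<in> {0..<2*pi}"
        using mpi_less_Im_Ln[OF z] Im_Ln_le_pi[OF z] pi_gt_zero unfolding g_def by (auto intro: less_le_trans)
      show "cis (g z) = z" using c by (simp add: g_def flip: cis_mult)
    qed
    have g_cis: "g (cis t) = t" if "t \<in> {0..<2*pi}" for t
    proof -
      have "cis (g (cis t)) = cis t" "g (cis t) \<in> {0..<2*pi}" using g_range cis_g by auto
      then show ?thesis
        using that
        by (smt (verit) Arg2pi_unique atLeastLessThan_iff cis_conv_exp mult_1 of_real_1)
    qed
    have "{t \<in> {0..<2*pi}. cis t \<in> N} \<in> null_sets lborel"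
    proof (rule null_sets_subset[OF P(1)])
      have "cis -` N \<in> sets borel" using measurable_sets[OF cis_borel, of N] N by auto
      hence "{t \<in> {0..<2*pi}. cis t \<in> N} \<in> sets borel"
        using sets.Int[of "cis -` N" borel "{0..<2*pi}"] by (simp add: vimage_def Int_def conj_commute)
      thus "{t \<in> {0..<2*pi}. cis t \<in> N} \<in> sets lborel" by simp
      show "{t \<in> {0..<2*pi}. cis t \<in> N} \<subseteq> P" using g_cis by (auto simp: N_def)
    qed
    hence "N \<in> null_sets ?D" using N D_null by blast
    moreover have "E \<subseteq> N"
    proof
      fix z assume "z \<in> E"
      moreover have "norm z = 1" using \<open>z \<in> E\<close> assms by auto
      ultimately show "z \<in> N" using P(2) g_range[of z] cis_g[of z] by (auto simp: N_def)
    qed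
    ultimately show "E \<in> null_sets circle_lebesgue"
      unfolding circle_lebesgue_def null_sets_completion_iff2 by blast
  qed
qed

end

theory Submission
  imports Defs "Jordan_Normal_Form.Determinant"
begin

text \<open>Let \<open>W\<close> be the Wronskian of \<open>f\<^sub>0, \<dots>, f\<^sub>n\<close>. Suppose that \<open>g = \<Sum> c\<^sub>j f\<^sub>j\<close> with \<open>c\<^sub>i \<noteq> 0\<close> is
  \<open>o((1 - |z|)\<^sup>\<gamma>)\<close> in a Stolz region at \<open>\<zeta>\<close>. Replacing the row of \<open>f\<^sub>i\<close> by the row of \<open>g\<close> multiplies
  \<open>W\<close> by \<open>c\<^sub>i\<close>. By Cauchy's estimates each derivative costs one power of \<open>1 - |z|\<close>, so in every
  slightly smaller Stolz region each term of the expanded determinant is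
  \<open>o((1 - |z|)\<^sup>e)\<close> with \<open>e = \<gamma> - n\<beta> - (0 + 1 + \<dots> + n) = 0\<close>: this is where the value of
  \<open>\<gamma>\<close> comes from. Hence \<open>W\<close> has nontangential limit \<open>0\<close> at every point of the exceptional set
  (\<open>wronskian_tendsto_0\<close>). Since \<open>W\<close> does not vanish identically when the \<open>f\<^sub>j\<close> are linearly
  independent (\<open>wronskian_not_identically_zero\<close>), the Lusin--Privalov uniqueness theorem
  (\<open>lusin_privalov\<close>) shows that this set is null.

  The uniqueness theorem is usually derived from the F. and M. Riesz theorem on a conformal map of a
  sawtooth region. Here a harmonic majorant on the sawtooth region does the work instead. If \<open>W\<close> tended
  to \<open>0\<close> on a set of positive measure, Egorov's argument would give a compact set \<open>F\<close> of positive
  measure on which the convergence is uniform. The sawtooth region \<open>\<Omega>\<close> over \<open>F\<close> is the union of the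
  Stolz regions at points of \<open>F\<close>, and \<open>|W|\<close> is bounded there and uniformly small near the circle. Let
  \<open>I\<close> be an arc almost filled by \<open>F\<close>. The Poisson integral of \<open>I - F\<close> is small above the centre of
  \<open>I\<close>, but it is bounded below on the part of \<open>\<partial>\<Omega>\<close> inside the disc and near \<open>I\<close>,
  because a boundary point at height \<open>h\<close> lies over an arc of length comparable to \<open>h\<close> that misses \<open>F\<close>. So there is
  a holomorphic \<open>V\<close> with \<open>Re V \<le> 0\<close> on the inner boundary of \<open>\<Omega>\<close>, \<open>Re V \<le> 1\<close> everywhere, and
  \<open>Re V > 0\<close> at some point \<open>z\<^sub>0\<close> of \<open>\<Omega>\<close>. The maximum principle for \<open>W exp(N V)\<close> bounds this function
  on \<open>\<Omega>\<close> independently of \<open>N\<close>, and \<open>N \<rightarrow> \<infinity>\<close> gives \<open>W = 0\<close> near \<open>z\<^sub>0\<close>.\<close>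

section \<open>Density and uniformity in measure\<close>

text \<open>A weak form of Lebesgue's density theorem: \<open>F\<close> has an open superset of almost the same
  measure, and by Vitali's theorem disjoint small balls inside that superset cover \<open>F\<close> up to a null set.
  If \<open>F\<close> missed a fixed proportion of each of them, the superset would be too large.\<close>

lemma ball_of_high_density:
  fixes F :: "'a::euclidean_space set"
  assumes F: "F \<in> lmeasurable" "\<not> negligible F" and "0 < \<eta>" "0 < d"
  obtains m r where "0 < r" "r < d"
    "measure lebesgue (ball m r - F) < \<eta> * measure lebesgue (ball m r)"
proof (rule ccontr)
  note main = that
  assume "\<not> thesis"
  with main have big: "\<eta> * measure lebesgue (ball m r) \<le> measure lebesgue (ball m r - F)"
    if "0 < r" "r < d" for m r
    using that by (meson not_le)
  have Fpos: "0 < measure lebesgue F"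
    using F by (simp add: negligible_iff_measure zero_less_measure_iff)
  have Fleb: "F \<in> sets lebesgue" using F by (simp add: fmeasurableD)
  obtain U where U: "open U" "F \<subseteq> U" "U - F \<in> lmeasurable"
      "emeasure lebesgue (U - F) < ennreal (\<eta> * measure lebesgue F)"
    using sets_lebesgue_outer_open[OF Fleb, of "\<eta> * measure lebesgue F"] Fpos \<open>0 < \<eta>\<close>
    by (metis mult_pos_pos)
  define K where "K = {(m, r). 0 < r \<and> r < d \<and> ball m r \<subseteq> U}"
  have cover: "\<exists>i. i \<in> K \<and> x \<in> ball (fst i) (snd i) \<and> snd i < e" if "x \<in> F" "0 < e" for x e
  proof -
    obtain r0 where r0: "0 < r0" "ball x r0 \<subseteq> U"
      using U \<open>x \<in> F\<close> open_contains_ball by blast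
    define r where "r = min r0 (min (d/2) (e/2))"
    have "(x, r) \<in> K"
      unfolding K_def r_def using r0 \<open>0 < d\<close> \<open>0 < e\<close> by auto
    moreover have "0 < r" "r < e"
      unfolding r_def using r0 \<open>0 < d\<close> \<open>0 < e\<close> by auto
    ultimately show ?thesis
      by (metis centre_in_ball fst_conv snd_conv)
  qed
  obtain C where C: "countable C" "C \<subseteq> K"
      "pairwise (\<lambda>i j. disjnt (ball (fst i) (snd i)) (ball (fst j) (snd j))) C"
      "negligible (F - (\<Union>i\<in>C. ball (fst i) (snd i)))"
    using Vitali_covering_theorem_balls[of F K fst snd] cover by blast
  let ?b = "\<lambda>i. ball (fst i) (snd i)"
  define B where "B = (\<Union>i\<in>C. ?b i)"
  have disj: "disjoint_family_on ?b C"
    using C(3) by (simp add: disjoint_family_on_def pairwise_def disjnt_def)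
  hence disj': "disjoint_family_on (\<lambda>i. ?b i - F) C"
    unfolding disjoint_family_on_def by blast
  have "B \<subseteq> U" using C(2) by (fastforce simp: B_def K_def)
  have Bo: "open B" by (auto simp: B_def)
  have "emeasure lebesgue B = (\<integral>\<^sup>+i. emeasure lebesgue (?b i) \<partial>count_space C)"
    unfolding B_def using C(1) disj by (intro emeasure_UN_countable) auto
  moreover have "emeasure lebesgue (B - F) = (\<integral>\<^sup>+i. emeasure lebesgue (?b i - F) \<partial>count_space C)"
  proof -
    have "B - F = (\<Union>i\<in>C. ?b i - F)" by (auto simp: B_def)
    moreover have "?b i - F \<in> sets lebesgue" for i
      using Fleb by (intro sets.Diff) auto
    ultimately show ?thesis
      using emeasure_UN_countable[where X = "\<lambda>i. ?b i - F" and I = C and M = lebesgue] disj' C(1)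
      by (simp only:)
  qed
  moreover have "ennreal \<eta> * emeasure lebesgue (?b i) \<le> emeasure lebesgue (?b i - F)" if "i \<in> C" for i
  proof -
    have "0 < snd i" "snd i < d" using C(2) that by (auto simp: K_def)
    from big[OF this, of "fst i"]
    have "ennreal (\<eta> * measure lebesgue (?b i)) \<le> ennreal (measure lebesgue (?b i - F))"
      by (rule ennreal_leI)
    moreover have "?b i - F \<in> lmeasurable"
      by (intro fmeasurable_Diff lmeasurable_ball Fleb)
    ultimately show ?thesis
      using \<open>0 < \<eta>\<close> by (simp add: emeasure_eq_measure2 ennreal_mult'')
  qed
  ultimately have "ennreal \<eta> * emeasure lebesgue B \<le> emeasure lebesgue (B - F)"
    using nn_integral_mono[of "count_space C" "\<lambda>i. ennreal \<eta> * emeasure lebesgue (?b i)" "\<lambda>i. emeasure lebesgue (?b i - F)"]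
    by (simp only: nn_integral_cmult measurable_count_space_eq1 space_count_space UNIV_I space_borel Pi_UNIV)
  moreover have "emeasure lebesgue F \<le> emeasure lebesgue B"
  proof -
    have "emeasure lebesgue F \<le> emeasure lebesgue (B \<union> (F - B))"
      using Bo C(4) Fleb by (intro emeasure_mono) auto
    also have "\<dots> = emeasure lebesgue B"
      using Bo C(4) by (intro emeasure_Un_null_set) (auto simp: B_def negligible_iff_null_sets)
    finally show ?thesis .
  qed
  moreover have "emeasure lebesgue (B - F) \<le> emeasure lebesgue (U - F)"
    using \<open>B \<subseteq> U\<close> U Fleb by (intro emeasure_mono) auto
  moreover have "emeasure lebesgue F = ennreal (measure lebesgue F)"
    using F by (simp add: emeasure_eq_measure2)
  ultimately have "ennreal \<eta> * ennreal (measure lebesgue F) \<le> emeasure lebesgue (U - F)"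
    using mult_left_mono[of "emeasure lebesgue F" "emeasure lebesgue B" "ennreal \<eta>"]
    by (metis order_trans zero_le)
  with U(4) have "ennreal \<eta> * ennreal (measure lebesgue F) < ennreal (\<eta> * measure lebesgue F)"
    by (rule le_less_trans[rotated])
  thus False using \<open>0 < \<eta>\<close> by (simp add: ennreal_mult)
qed

text \<open>Egorov's theorem in terms of sets. Read \<open>A j k\<close> as the set of points at which a convergence has
  reached accuracy \<open>1/j\<close> from stage \<open>k\<close> on. Convergence at each point then becomes uniform
  on a set of positive measure, with \<open>k\<close> a function of \<open>j\<close> alone.\<close>

lemma (in finite_measure) egorov_sets:
  fixes A :: "nat \<Rightarrow> nat \<Rightarrow> 'a set"
  assumes meas: "\<And>j k. A j k \<in> sets M"
    and mono: "\<And>j. incseq (A j)"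
    and pos: "0 < measure M (\<Inter>j. \<Union>k. A j k)"
  obtains k where "0 < measure M (\<Inter>j. A j (k j))"
proof -
  define E where "E = (\<Inter>j. \<Union>k. A j k)"
  have E[measurable]: "E \<in> sets M" unfolding E_def using meas by auto
  have ex: "\<exists>k. measure M (E - A j k) < measure M E / 2 * (1/2)^Suc j" for j
  proof -
    have "(\<lambda>k. measure M (E - A j k)) \<longlonglongrightarrow> measure M (\<Inter>k. E - A j k)"
    proof (intro finite_Lim_measure_decseq)
      show "decseq (\<lambda>k. E - A j k)"
        using mono[of j] unfolding decseq_def incseq_def by blast
    qed (use meas E in auto)
    moreover have "(\<Inter>k. E - A j k) = {}" by (auto simp: E_def)
    ultimately have "(\<lambda>k. measure M (E - A j k)) \<longlonglongrightarrow> 0" by (simp only: measure_empty)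
    moreover have "0 < measure M E / 2 * (1/2)^Suc j" using pos by (simp add: E_def)
    ultimately have "eventually (\<lambda>k. measure M (E - A j k) < measure M E / 2 * (1/2)^Suc j) sequentially"
      by (rule order_tendstoD(2))
    thus ?thesis by (auto simp: eventually_sequentially)
  qed
  then obtain k where k: "\<And>j. measure M (E - A j (k j)) < measure M E / 2 * (1/2)^Suc j"
    by metis
  have sm: "(\<lambda>j. measure M E / 2 * (1/2)^Suc j) sums (measure M E / 2)"
    using sums_mult[OF power_half_series, of "measure M E / 2"] by simp
  have smb: "summable (\<lambda>j. measure M (E - A j (k j)))"
    by (rule summable_comparison_test'[OF sums_summable[OF sm], where N = 0]) (use k less_imp_le in auto)
  have "measure M (\<Union>j. E - A j (k j)) \<le> (\<Sum>j. measure M (E - A j (k j)))"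
    using meas smb by (intro finite_measure_subadditive_countably) auto
  also have "\<dots> \<le> (\<Sum>j. measure M E / 2 * (1/2)^Suc j)"
    using k less_imp_le by (intro suminf_le smb sums_summable[OF sm]) blast
  also have "\<dots> = measure M E / 2" using sm by (simp add: sums_iff)
  finally have half: "measure M (\<Union>j. E - A j (k j)) \<le> measure M E / 2" .
  have "measure M E \<le> measure M ((\<Inter>j. A j (k j)) \<union> (\<Union>j. E - A j (k j)))"
    using meas by (intro finite_measure_mono) auto
  also have "\<dots> \<le> measure M (\<Inter>j. A j (k j)) + measure M (\<Union>j. E - A j (k j))"
    using meas by (intro measure_Un_le) auto
  finally have "0 < measure M (\<Inter>j. A j (k j))" using half pos by (simp add: E_def)
  thus thesis using that by blast
qed


section \<open>Cauchy transforms of masses on the circle\<close>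

lemma norm_one_minus_mult_cis:
  "norm (1 - z * cis (-t)) = norm (cis t - z)"
proof -
  have "1 - z * cis (-t) = (cis t - z) * cis (-t)"
    by (simp add: algebra_simps cis_mult)
  thus ?thesis by (simp add: norm_mult)
qed

lemma Re_inverse_one_minus:
  fixes w :: complex
  shows "Re (1 / (1 - w)) = (1 - Re w) / (norm (1 - w))\<^sup>2"
  by (simp add: Re_divide cmod_power2)

lemma Re_inverse_one_minus_nonneg:
  fixes w :: complex
  assumes "norm w \<le> 1"
  shows "0 \<le> Re (1 / (1 - w))"
  using complex_Re_le_cmod[of w] assms by (simp add: Re_inverse_one_minus)

lemma Re_inverse_one_minus_ge:
  fixes w :: complex
  assumes "norm w < 1" "norm (1 - w) \<le> k * (1 - norm w)"
  shows "1 / (k\<^sup>2 * (1 - norm w)) \<le> Re (1 / (1 - w))"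
proof -
  have w1: "w \<noteq> 1" using assms(1) by auto
  have n0: "0 < norm (1 - w)" using w1 by simp
  have k0: "0 < k" using n0 assms
    by (meson diff_gt_0_iff_gt order_less_le_trans zero_less_mult_pos2)
  have "1 / (k\<^sup>2 * (1 - norm w)) = (1 - norm w) / (k * (1 - norm w))\<^sup>2"
    using assms(1) k0 by (simp add: power2_eq_square)
  also have "\<dots> \<le> (1 - Re w) / (norm (1 - w))\<^sup>2"
    using assms n0 complex_Re_le_cmod[of w] by (intro frac_le power_mono) auto
  finally show ?thesis by (simp add: Re_inverse_one_minus)
qed

lemma abs_arctan_le: "\<bar>arctan x\<bar> \<le> \<bar>x\<bar>"
  using arctan_le_self[of x] arctan_le_self[of "-x"]
  by (cases "0 \<le> x") (auto simp: arctan_minus abs_if)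

lemma abs_Arg_le:
  assumes "norm (w - 1) < r" "r \<le> 1 / 2"
  shows "\<bar>Arg w\<bar> \<le> 2 * r"
proof -
  have re: "\<bar>Re w - 1\<bar> < r" and im: "\<bar>Im w\<bar> < r"
    using abs_Re_le_cmod[of "w - 1"] abs_Im_le_cmod[of "w - 1"] assms by auto
  have "1 / 2 < Re w" using re assms by linarith
  hence "Arg w = arctan (Im w / Re w)" by (simp add: arg_conv_arctan)
  also have "\<bar>\<dots>\<bar> \<le> \<bar>Im w / Re w\<bar>"
    by (rule abs_arctan_le)
  also have "\<dots> \<le> \<bar>Im w\<bar> / (1/2)"
    unfolding abs_divide using \<open>1 / 2 < Re w\<close> by (intro divide_left_mono) auto
  finally show ?thesis using im by simp
qed

lemma dist_cis_le: "norm (cis a - cis b) \<le> \<bar>a - b\<bar>"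
proof -
  have "cis a - cis b = cis b * (exp (\<i> * of_real (a - b)) - 1)"
    by (simp only: cis_conv_exp[symmetric] right_diff_distrib cis_mult) simp
  hence "norm (cis a - cis b) = 2 * \<bar>sin ((a - b) / 2)\<bar>"
    by (simp only: norm_mult norm_cis dist_exp_i_1 mult_1)
  also have "\<dots> \<le> 2 * \<bar>(a - b) / 2\<bar>"
    using abs_sin_x_le_abs_x[of "(a - b) / 2"] by simp
  finally show ?thesis by simp
qed

text \<open>Integrating the geometric series of the kernel term by term gives a power series in \<open>z\<close>.\<close>

lemma (in finite_measure) holomorphic_on_integral_geometric_kernel:
  fixes g :: "'a \<Rightarrow> complex"
  assumes g: "g \<in> borel_measurable M" "\<And>t. norm (g t) \<le> 1"
  shows "(\<lambda>z. LINT t|M. 1 / (1 - z * g t)) holomorphic_on ball 0 1"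
proof (rule power_series_holomorphic)
  fix z :: complex assume "z \<in> ball 0 1"
  hence z: "norm z < 1" by simp
  have bd: "norm (z ^ i * g t ^ i) \<le> norm z ^ i" for i t
    using g(2)[of t] by (simp add: norm_mult norm_power mult_left_le power_le_one)
  have int: "integrable M (\<lambda>t. z ^ i * g t ^ i)" for i
    using g(1) bd by (intro integrable_const_bound[where B = "norm z ^ i"]) auto
  have "(\<lambda>i. LINT t|M. z ^ i * g t ^ i) sums (LINT t|M. (\<Sum>i. z ^ i * g t ^ i))"
  proof (rule sums_integral[OF int])
    show "AE t in M. summable (\<lambda>i. norm (z ^ i * g t ^ i))"
      by (intro always_eventually allI summable_comparison_test'[OF summable_geometric[of "norm z"]])
         (use z bd in auto)
    have "(LINT t|M. norm (z ^ i * g t ^ i)) \<le> measure M (space M) * norm z ^ i" for i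
      using integral_mono[of M "\<lambda>t. norm (z ^ i * g t ^ i)" "\<lambda>_. norm z ^ i"] int bd
      by (simp add: integrable_norm)
    thus "summable (\<lambda>i. LINT t|M. norm (z ^ i * g t ^ i))"
      by (intro summable_comparison_test'[OF summable_mult[OF summable_geometric[of "norm z"], of "measure M (space M)"]])
         (use z in auto)
  qed
  moreover have "(\<Sum>i. z ^ i * g t ^ i) = 1 / (1 - z * g t)" for t
  proof -
    have "norm (z * g t) < 1"
      using bd[of 1 t] z by simp
    from suminf_geometric[OF this] show ?thesis by (simp add: power_mult_distrib)
  qed
  ultimately show "(\<lambda>i. (LINT t|M. g t ^ i) * (z - 0) ^ i) sums (LINT t|M. 1 / (1 - z * g t))"
    by (simp add: mult.commute)
qed

text \<open>A finite mass \<open>M\<close> on the circle, parametrised by the angle. For \<open>|\<zeta>| = 1\<close> the real part of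
  \<open>1 / (1 - z / \<zeta>)\<close> is \<open>1/2\<close> plus half the Poisson kernel. Up to normalisation, the real part of
  \<open>cauchy_transform\<close> is therefore the Poisson integral of \<open>M\<close> plus a nonnegative constant, and the two bounds below
  are those of a harmonic majorant: it is small at points high above a small mass, and bounded
  below at points close to an arc that carries mass comparable to the distance.\<close>

locale circle_mass = finite_measure M for M :: "real measure" +
  assumes cis_measurable: "(\<lambda>t. cis (-t)) \<in> borel_measurable M"
begin

definition cauchy_transform :: "complex \<Rightarrow> complex" where
  "cauchy_transform z = (LINT t|M. 1 / (1 - z * cis (-t)))"

lemma cauchy_transform_holomorphic: "cauchy_transform holomorphic_on ball 0 1"
  unfolding cauchy_transform_def by (rule holomorphic_on_integral_geometric_kernel[OF cis_measurable]) simp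

lemma norm_kernel_le:
  assumes "norm z < 1"
  shows "norm (1 / (1 - z * cis (-t))) \<le> 1 / (1 - norm z)"
proof -
  have "1 - norm z \<le> norm (1 - z * cis (-t))"
    using norm_triangle_ineq2[of 1 "z * cis (-t)"] by (simp add: norm_mult)
  thus ?thesis using assms by (simp add: norm_divide frac_le)
qed

lemma kernel_integrable:
  assumes "norm z < 1"
  shows "integrable M (\<lambda>t. 1 / (1 - z * cis (-t)))"
  using norm_kernel_le[OF assms] cis_measurable
  by (intro integrable_const_bound[where B = "1 / (1 - norm z)"]) auto

lemma norm_cauchy_transform_le:
  assumes "norm z < 1"
  shows "norm (cauchy_transform z) \<le> measure M (space M) / (1 - norm z)"
proof -
  have "norm (cauchy_transform z) \<le> (LINT t|M. norm (1 / (1 - z * cis (-t))))"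
    unfolding cauchy_transform_def by (rule integral_norm_bound)
  also have "\<dots> \<le> (LINT t|M. 1 / (1 - norm z))"
    using kernel_integrable[OF assms] norm_kernel_le[OF assms] by (intro integral_mono integrable_norm) auto
  finally show ?thesis by simp
qed

lemma Re_cauchy_transform:
  assumes "norm z < 1"
  shows "Re (cauchy_transform z) = (LINT t|M. Re (1 / (1 - z * cis (-t))))"
  unfolding cauchy_transform_def by (simp only: integral_Re[OF kernel_integrable[OF assms]])

lemma Re_cauchy_transform_nonneg:
  assumes "norm z < 1"
  shows "0 \<le> Re (cauchy_transform z)"
  unfolding Re_cauchy_transform[OF assms]
  using assms by (intro integral_nonneg_AE always_eventually allI Re_inverse_one_minus_nonneg) (simp add: norm_mult)

lemma Re_cauchy_transform_ge:
  assumes z: "norm z < 1" and J: "J \<in> sets M"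
    and near: "\<And>t. t \<in> J \<Longrightarrow> norm (cis t - z) \<le> k * (1 - norm z)"
  shows "measure M J / (k\<^sup>2 * (1 - norm z)) \<le> Re (cauchy_transform z)"
proof -
  have "measure M J / (k\<^sup>2 * (1 - norm z)) = (LINT t|M. indicator J t * (1 / (k\<^sup>2 * (1 - norm z))))"
    using J by (simp add: sets.Int_space_eq2)
  also have "\<dots> \<le> (LINT t|M. Re (1 / (1 - z * cis (-t))))"
  proof (rule integral_mono)
    show "integrable M (\<lambda>t. indicator J t * (1 / (k\<^sup>2 * (1 - norm z))))"
      using J by (intro integrable_mult_left) (simp add: emeasure_finite less_top[symmetric])
    show "integrable M (\<lambda>t. Re (1 / (1 - z * cis (-t))))"
      using kernel_integrable[OF z] by (rule integrable_Re)
    fix t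
    show "indicator J t * (1 / (k\<^sup>2 * (1 - norm z))) \<le> Re (1 / (1 - z * cis (-t)))"
    proof (cases "t \<in> J")
      case True
      have "1 / (k\<^sup>2 * (1 - norm (z * cis (-t)))) \<le> Re (1 / (1 - z * cis (-t)))"
        using z near[OF True]
        by (intro Re_inverse_one_minus_ge) (simp_all add: norm_mult norm_one_minus_mult_cis del: minus_mult_right)
      thus ?thesis using True by (simp add: norm_mult)
    next
      case False
      have "0 \<le> Re (1 / (1 - z * cis (-t)))"
        using z by (intro Re_inverse_one_minus_nonneg) (simp add: norm_mult)
      thus ?thesis using False by simp
    qed
  qed
  finally show ?thesis by (simp only: Re_cauchy_transform[OF z])
qed

end

section \<open>The Lusin--Privalov uniqueness theorem\<close>

lemma circle_mass_restrict_lborel: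
  assumes "U \<in> sets borel" "U \<in> lmeasurable"
  shows "circle_mass (restrict_space lborel U)"
proof -
  have "(\<lambda>t. cis (-t)) \<in> borel_measurable lborel"
    by (simp, intro borel_measurable_continuous_onI continuous_intros)
  moreover have "emeasure lborel U < \<infinity>"
    using assms fmeasurableD2 by (fastforce simp: fmeasurable_def)
  hence "finite_measure (restrict_space lborel U)"
    using assms(1) by (intro finite_measureI) (simp add: emeasure_restrict_space space_restrict_space)
  ultimately show ?thesis
    by (simp add: circle_mass_def circle_mass_axioms_def measurable_restrict_space1)
qed

text \<open>The core of the uniqueness theorem: uniform smallness in the Stolz regions over a compact set
  of positive measure forces \<open>W\<close> to vanish. The set \<open>\<Omega>\<close> is the sawtooth region over \<open>F\<close>, and \<open>V\<close> is the exponent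
  for the maximum principle. In \<open>V\<close>, the term \<open>Q\<close> localises to the arc \<open>I\<close> of half-length \<open>r\<close> around \<open>cis m\<close>: it equals
  \<open>1/2\<close> at \<open>z0\<close>, at height \<open>s = r/16\<close> above the centre, and has real part at most \<open>1/4\<close>, the constant
  subtracted in \<open>V\<close>, at distance \<open>r/4\<close> or more from the centre. The \<open>cauchy_transform\<close> of \<open>I - F\<close> is divided by \<open>c\<close>, a lower
  bound for its real part on the inner boundary of \<open>\<Omega>\<close> near \<open>I\<close>; the density \<open>1 - c/256\<close> of \<open>F\<close> in \<open>I\<close> makes the quotient
  at most \<open>1/8\<close> at \<open>z0\<close>.\<close>

lemma privalov_uniform_smallness:
  fixes W :: "complex \<Rightarrow> complex" and T :: "real set"
  assumes W: "W holomorphic_on ball 0 1"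
    and T: "compact T" "\<not> negligible T"
    and \<kappa>: "0 < \<kappa>" "\<kappa> \<le> 1/2"
    and small: "\<And>e. 0 < e \<Longrightarrow> \<exists>d>0. \<forall>t\<in>T. \<forall>z. norm z < 1 \<and> 1 - d < norm z \<and>
                   norm (cis t - z) \<le> (1 + \<kappa>) * (1 - norm z) \<longrightarrow> norm (W z) \<le> e"
    and z: "z \<in> ball 0 1"
  shows "W z = 0"
proof -
  define F where "F = cis ` T"
  have "T \<noteq> {}" using T(2) by auto
  have F: "compact F" "F \<noteq> {}"
    unfolding F_def using T(1) \<open>T \<noteq> {}\<close>
    by (auto intro!: compact_continuous_image continuous_intros)
  define c where "c = 2 * \<kappa> / (1 + \<kappa>)\<^sup>2"
  have c: "0 < c" "c \<le> 2 * \<kappa>"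
  proof -
    show "0 < c" using \<kappa> by (simp add: c_def)
    have "2 * \<kappa> / (1 + \<kappa>)\<^sup>2 \<le> 2 * \<kappa> / 1"
      using \<kappa> by (intro divide_left_mono) auto
    thus "c \<le> 2 * \<kappa>" by (simp add: c_def)
  qed
  have Tm: "T \<in> lmeasurable" using T(1) by (rule lmeasurable_compact)
  obtain m r where r: "0 < r" "r < 1/2"
      and dens: "measure lebesgue (ball m r - T) < c / 256 * measure lebesgue (ball m r)"
  proof (rule ball_of_high_density[OF Tm T(2), of "c/256" "1/2"])
  qed (use c in auto)
  define U where "U = ball m r - T"
  have Ub: "U \<in> sets borel"
    unfolding U_def using T(1) by (intro sets.Diff borel_compact borel_open) auto
  have Um: "U \<in> lmeasurable"
    unfolding U_def using Tm by (intro fmeasurable_Diff) auto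
  define M where "M = restrict_space lborel U"
  interpret circle_mass M
    unfolding M_def by (rule circle_mass_restrict_lborel[OF Ub Um])
  have spM: "space M = U" by (simp add: M_def space_restrict_space)
  have measM: "measure M J = measure lebesgue J" and setsM: "J \<in> sets M"
    if "J \<in> sets borel" "J \<subseteq> U" for J
    using that Ub by (auto simp: M_def measure_restrict_space sets_restrict_space_iff)
  have mass: "measure M (space M) < c / 128 * r"
    using dens r measM[OF Ub] spM by (simp add: U_def content_ball)
  define s where "s = r / 16"
  have s: "0 < s" "s < 1" using r by (auto simp: s_def)
  define Q where "Q z = of_real s / (of_real (1 + s) - z * cis (-m))" for z
  define V where "V z = Q z - 1/4 - cauchy_transform z / of_real c" for z
  define z0 where "z0 = of_real (1 - s) * cis m"
  have nz0: "norm z0 = 1 - s"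
    using s by (simp only: z0_def norm_mult norm_cis norm_of_real) simp

  have den: "s \<le> norm (of_real (1 + s) - z * cis (-m))"
      "norm (cis m - z) \<le> norm (of_real (1 + s) - z * cis (-m))" if "norm z < 1" for z
  proof -
    let ?w = "z * cis (-m)"
    have w: "norm ?w < 1" using that by (simp add: norm_mult)
    have re: "Re ?w \<le> 1" using complex_Re_le_cmod[of ?w] w by linarith
    show "s \<le> norm (of_real (1 + s) - ?w)"
      using complex_Re_le_cmod[of "of_real (1 + s) - ?w"] re s by (simp only: minus_complex.sel Re_complex_of_real)
    have "(norm (1 - ?w))\<^sup>2 \<le> (norm (of_real (1 + s) - ?w))\<^sup>2"
      unfolding cmod_power2 using re s
      by (simp only: minus_complex.sel Re_complex_of_real Im_complex_of_real one_complex.sel)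
         (simp only: add_le_cancel_right, intro power_mono, linarith+)
    hence "norm (1 - ?w) \<le> norm (of_real (1 + s) - ?w)"
      by (rule power2_le_imp_le) simp
    thus "norm (cis m - z) \<le> norm (of_real (1 + s) - ?w)"
      by (simp only: norm_one_minus_mult_cis)
  qed
  have Q1: "Re (Q z) \<le> 1" if "norm z < 1" for z
  proof -
    have "norm (Q z) \<le> 1"
      unfolding Q_def using den(1)[OF that] s by (simp add: norm_divide divide_le_eq_1)
    thus ?thesis using complex_Re_le_cmod order_trans by blast
  qed
  have Q2: "Re (Q z) \<le> 1/4" if "norm z < 1" "r / 4 \<le> norm (cis m - z)" for z
  proof -
    have "r / 4 \<le> norm (of_real (1 + s) - z * cis (-m))"
      using den(2)[OF that(1)] that(2) by linarith
    hence "norm (Q z) \<le> s / (r / 4)"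
      unfolding Q_def norm_divide using r s by (intro frac_le) auto
    also have "\<dots> = 1/4" using r by (simp add: s_def)
    finally show ?thesis using complex_Re_le_cmod order_trans by blast
  qed
  have Vhol: "V holomorphic_on ball 0 1"
  proof -
    have "of_real (1 + s) - z * cis (-m) \<noteq> 0" if "z \<in> ball 0 1" for z
      using den(1)[of z] that s by auto
    thus ?thesis
      unfolding V_def Q_def
      using c by (intro holomorphic_intros cauchy_transform_holomorphic) auto
  qed
  have ReV: "Re (V z) = Re (Q z) - 1/4 - Re (cauchy_transform z) / c" for z
    by (simp add: V_def)

  define \<Omega> where "\<Omega> = {z. norm z < 1 \<and> infdist z F < (1 + \<kappa>) * (1 - norm z)}"
  have \<Omega>open: "open \<Omega>"
  proof -
    have "\<Omega> = {z. norm z < 1} \<inter> {z. infdist z F < (1 + \<kappa>) * (1 - norm z)}"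
      by (auto simp: \<Omega>_def)
    thus ?thesis by (auto intro!: open_Int open_Collect_less continuous_intros)
  qed
  have cone: "\<exists>t\<in>T. norm (cis t - z) \<le> (1 + \<kappa>) * (1 - norm z)"
    if "infdist z F \<le> (1 + \<kappa>) * (1 - norm z)" for z
  proof -
    obtain x where "x \<in> F" "infdist z F = dist z x"
      using infdist_attains_inf[of F z] F compact_imp_closed by blast
    thus ?thesis using that by (auto simp: F_def dist_norm norm_minus_commute)
  qed

  have hc: "0 \<le> Re (cauchy_transform z) / c" if "norm z < 1" for z
    using Re_cauchy_transform_nonneg[OF that] c by simp
  (* Far from the arc the localising term alone makes V nonpositive. Near it, z lies at height h
     over an arc of half-length \<kappa> h that misses F, and the mass of that arc suffices. *)
  have Vneg: "Re (V z) \<le> 0"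
    if z: "norm z < 1" and far: "(1 + \<kappa>) * (1 - norm z) \<le> infdist z F" for z
  proof (cases "norm (cis m - z) < r / 4")
    case False
    thus ?thesis using Q2[OF z] hc[OF z] by (simp add: ReV)
  next
    case True
    define w where "w = z * cis (-m)"
    have w1: "norm (w - 1) < r / 4"
      using True norm_one_minus_mult_cis[of z m] by (simp only: w_def norm_minus_commute[of _ 1])
    have wz: "norm w = norm z" by (simp add: w_def norm_mult)
    define \<theta> where "\<theta> = m + Arg w"
    have Argw: "\<bar>\<theta> - m\<bar> \<le> r / 2"
      using abs_Arg_le[OF w1] r by (simp add: \<theta>_def)
    have zpol: "z = of_real (norm z) * cis \<theta>"
    proof -
      have "z = w * cis m" by (simp add: w_def cis_mult)
      also have "w = of_real (norm z) * cis (Arg w)"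
        using wz by (metis rcis_cmod_Arg rcis_def)
      finally show ?thesis by (simp add: \<theta>_def cis_mult mult.assoc add.commute)
    qed
    define h where "h = 1 - norm z"
    have h: "0 < h" "h < r / 4"
      using z True norm_triangle_ineq2[of "cis m" z] by (auto simp: h_def)
    have dz: "norm (cis t - z) \<le> \<bar>t - \<theta>\<bar> + h" for t
    proof -
      have "cis \<theta> - z = of_real h * cis \<theta>"
        using zpol by (simp add: h_def left_diff_distrib)
      hence "norm (cis \<theta> - z) = h" using h(1) by (simp add: norm_mult)
      thus ?thesis
        using norm_triangle_ineq[of "cis t - cis \<theta>" "cis \<theta> - z"] dist_cis_le[of t \<theta>] by simp
    qed
    let ?J = "ball \<theta> (\<kappa> * h)"
    have "\<kappa> * h \<le> 1/2 * (r / 4)" using \<kappa> h by (intro mult_mono) auto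
    have JU: "?J \<subseteq> U"
    proof
      fix t assume "t \<in> ?J"
      hence t: "\<bar>t - \<theta>\<bar> < \<kappa> * h" by (simp add: dist_real_def abs_minus_commute)
      have "\<bar>t - m\<bar> < r"
        using t Argw \<open>\<kappa> * h \<le> 1/2 * (r / 4)\<close> r by linarith
      moreover have "t \<notin> T"
      proof
        assume "t \<in> T"
        hence "infdist z F \<le> norm (cis t - z)"
          unfolding F_def by (metis dist_commute dist_norm imageI infdist_le)
        also have "\<dots> < \<kappa> * h + h" using dz[of t] t by simp
        also have "\<dots> = (1 + \<kappa>) * (1 - norm z)" by (simp add: h_def algebra_simps)
        finally show False using far by simp
      qed
      ultimately show "t \<in> U" by (simp add: U_def dist_real_def abs_minus_commute)
    qed
    have "measure M ?J / ((1 + \<kappa>)\<^sup>2 * (1 - norm z)) \<le> Re (cauchy_transform z)"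
    proof (rule Re_cauchy_transform_ge[OF z])
      show "?J \<in> sets M" using JU by (intro setsM) auto
      show "norm (cis t - z) \<le> (1 + \<kappa>) * (1 - norm z)" if "t \<in> ?J" for t
        using that dz[of t] by (simp add: dist_real_def abs_minus_commute h_def algebra_simps)
    qed
    moreover have "measure M ?J = 2 * \<kappa> * h"
      using measM[of ?J] JU h \<kappa> by (simp add: content_ball)
    ultimately have "c \<le> Re (cauchy_transform z)"
      using h by (simp add: c_def h_def)
    hence "1 \<le> Re (cauchy_transform z) / c" using c by simp
    thus ?thesis using Q1[OF z] by (simp add: ReV)
  qed

  (* The arc is so densely filled by F that some point of F is within \<kappa> s of its centre. *)
  have z0\<Omega>: "z0 \<in> \<Omega>"
  proof -
    have "\<exists>t\<in>T. \<bar>t - m\<bar> < \<kappa> * s"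
    proof (rule ccontr)
      assume no: "\<not> ?thesis"
      have "\<kappa> * s \<le> 1/2 * (r/16)" unfolding s_def using \<kappa> r by (intro mult_mono) auto
      hence sub: "ball m (\<kappa> * s) \<subseteq> U"
        using no r by (auto simp: U_def dist_real_def abs_minus_commute)
      have "measure M (ball m (\<kappa> * s)) \<le> measure M (space M)"
        by (rule bounded_measure)
      hence "2 * (\<kappa> * s) < c / 128 * r"
        using mass measM[of "ball m (\<kappa> * s)"] sub \<kappa> s by (simp add: content_ball)
      also have "\<dots> \<le> 2 * \<kappa> / 128 * r" using c r by (intro mult_right_mono divide_right_mono) auto
      finally show False using \<kappa> r by (simp add: s_def)
    qed
    then obtain t where t: "t \<in> T" "\<bar>t - m\<bar> < \<kappa> * s" by blast
    have "cis m - z0 = of_real s * cis m" by (simp add: z0_def algebra_simps)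
    hence "norm (cis m - z0) = s" using s by (simp add: norm_mult)
    hence "norm (cis t - z0) < \<kappa> * s + s"
      using norm_triangle_ineq[of "cis t - cis m" "cis m - z0"] dist_cis_le[of t m] t by simp
    moreover have "infdist z0 F \<le> norm (cis t - z0)"
      unfolding F_def using t(1) by (metis dist_commute dist_norm imageI infdist_le)
    ultimately have "infdist z0 F < (1 + \<kappa>) * s" by (simp add: algebra_simps)
    thus ?thesis using nz0 s by (simp add: \<Omega>_def)
  qed
  have Vz0: "0 < Re (V z0)"
  proof -
    have "of_real (1 + s) - z0 * cis (-m) = of_real (2 * s)"
      by (simp add: z0_def cis_mult mult.assoc)
    hence "Q z0 = of_real (s / (2 * s))" by (simp only: Q_def of_real_divide)
    hence "Re (Q z0) = s / (2 * s)" by (simp only: Re_complex_of_real)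
    hence "Re (Q z0) = 1/2" using s by simp
    moreover have "Re (cauchy_transform z0) \<le> c / 8"
    proof -
      have "Re (cauchy_transform z0) \<le> measure M (space M) / s"
        using norm_cauchy_transform_le[of z0] nz0 s complex_Re_le_cmod[of "cauchy_transform z0"] by simp
      also have "\<dots> \<le> (c / 128 * r) / s" using mass s by (intro divide_right_mono) auto
      also have "\<dots> = c / 8" using r by (simp add: s_def)
      finally show ?thesis .
    qed
    hence "Re (cauchy_transform z0) / c \<le> 1/8" using c by (simp add: divide_le_eq)
    ultimately show ?thesis unfolding ReV by linarith
  qed

  obtain C where C: "1 \<le> C"
      "\<And>z. norm z < 1 \<Longrightarrow> infdist z F \<le> (1 + \<kappa>) * (1 - norm z) \<Longrightarrow> norm (W z) \<le> C"
  proof -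
    obtain d where d: "0 < d" "\<forall>t\<in>T. \<forall>z. norm z < 1 \<and> 1 - d < norm z \<and>
                   norm (cis t - z) \<le> (1 + \<kappa>) * (1 - norm z) \<longrightarrow> norm (W z) \<le> 1"
      using small[of 1] by auto
    have "compact (W ` cball 0 (1 - d))"
      using W d(1) by (intro compact_continuous_image holomorphic_on_imp_continuous_on[OF holomorphic_on_subset[OF W]]) auto
    hence "bounded (W ` cball 0 (1 - d))" by (rule compact_imp_bounded)
    then obtain B where B: "\<And>z. norm z \<le> 1 - d \<Longrightarrow> norm (W z) \<le> B"
      unfolding bounded_iff by (metis imageI mem_cball_0)
    show thesis
    proof (rule that[of "max 1 B"])
      fix z assume z: "norm z < 1" "infdist z F \<le> (1 + \<kappa>) * (1 - norm z)"
      show "norm (W z) \<le> max 1 B"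
      proof (cases "norm z \<le> 1 - d")
        case True
        thus ?thesis using B by (simp add: le_max_iff_disj)
      next
        case False
        thus ?thesis using d(2) z cone[OF z(2)] by (fastforce simp: le_max_iff_disj)
      qed
    qed simp
  qed

  have bound: "norm (W z * exp (of_nat N * V z)) \<le> C" if z\<Omega>: "z \<in> \<Omega>" for z N
  proof -
    (* Cut \<Omega> off at a radius \<rho> so close to 1 that |W| is at most C exp(-N) on |z| = \<rho>; this outweighs
       exp(N Re V) there. On the rest of the frontier Re V is nonpositive and |W| is at most C. *)
    have "0 < C * exp (- real N)" using C(1) by simp
    then obtain d where d: "0 < d" "\<forall>t\<in>T. \<forall>z. norm z < 1 \<and> 1 - d < norm z \<and>
        norm (cis t - z) \<le> (1 + \<kappa>) * (1 - norm z) \<longrightarrow> norm (W z) \<le> C * exp (- real N)"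
      using small by blast
    have "norm z < 1" using z\<Omega> by (simp add: \<Omega>_def)
    then obtain \<rho> where \<rho>: "norm z < \<rho>" "1 - d < \<rho>" "\<rho> < 1"
      using dense[of "max (norm z) (1 - d)" 1] d(1) by auto
    define S where "S = \<Omega> \<inter> ball 0 \<rho>"
    have So: "open S" using \<Omega>open by (auto simp: S_def)
    have clS: "closure S \<subseteq> {z. norm z \<le> \<rho> \<and> infdist z F \<le> (1 + \<kappa>) * (1 - norm z)}"
    proof (rule closure_minimal)
      have "{z. norm z \<le> \<rho> \<and> infdist z F \<le> (1 + \<kappa>) * (1 - norm z)} =
          {z. norm z \<le> \<rho>} \<inter> {z. infdist z F \<le> (1 + \<kappa>) * (1 - norm z)}" by auto
      thus "closed {z. norm z \<le> \<rho> \<and> infdist z F \<le> (1 + \<kappa>) * (1 - norm z)}"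
        by (auto intro!: closed_Int closed_Collect_le continuous_intros)
    qed (auto simp: S_def \<Omega>_def)
    have hol: "(\<lambda>z. W z * exp (of_nat N * V z)) holomorphic_on ball 0 1"
      by (intro holomorphic_intros W Vhol)
    show ?thesis
    proof (rule maximum_modulus_frontier[where S = S and f = "\<lambda>z. W z * exp (of_nat N * V z)" and \<xi> = z])
      have sub: "interior S \<subseteq> ball 0 1" "closure S \<subseteq> ball 0 1"
      proof -
        show "closure S \<subseteq> ball 0 1" using clS \<rho> by auto
        thus "interior S \<subseteq> ball 0 1" using interior_subset closure_subset by blast
      qed
      show "(\<lambda>z. W z * exp (of_nat N * V z)) holomorphic_on interior S"
           "continuous_on (closure S) (\<lambda>z. W z * exp (of_nat N * V z))"
        using holomorphic_on_subset[OF hol sub(1)]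
          holomorphic_on_imp_continuous_on[OF holomorphic_on_subset[OF hol sub(2)]] by simp_all
      show "bounded S" by (rule bounded_subset[of "ball 0 \<rho>"]) (auto simp: S_def)
      show "z \<in> S" using z\<Omega> \<rho> by (simp add: S_def)
      fix x assume "x \<in> frontier S"
      hence xc: "norm x \<le> \<rho>" "infdist x F \<le> (1 + \<kappa>) * (1 - norm x)" and xS: "x \<notin> S"
        using clS So by (auto simp: frontier_def interior_open)
      have x1: "norm x < 1" using xc \<rho> by simp
      show "norm (W x * exp (of_nat N * V x)) \<le> C"
      proof (cases "norm x = \<rho>")
        case True
        have "norm (W x) \<le> C * exp (- real N)"
        proof -
          obtain t where "t \<in> T" "norm (cis t - x) \<le> (1 + \<kappa>) * (1 - norm x)"
            using cone[OF xc(2)] by blast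
          thus ?thesis using d(2) x1 True \<rho>(2) by simp
        qed
        moreover have "Re (V x) \<le> 1"
          using Q1[OF x1] hc[OF x1] by (simp add: ReV)
        hence "real N * Re (V x) \<le> real N * 1" by (rule mult_left_mono) simp
        hence "norm (exp (of_nat N * V x)) \<le> exp (real N)" by (simp add: norm_exp_eq_Re)
        ultimately have "norm (W x * exp (of_nat N * V x)) \<le> (C * exp (- real N)) * exp (real N)"
          unfolding norm_mult using C(1) by (intro mult_mono) auto
        also have "\<dots> = C" by (simp add: exp_minus)
        finally show ?thesis .
      next
        case False
        hence "(1 + \<kappa>) * (1 - norm x) \<le> infdist x F"
          using xS xc x1 unfolding S_def \<Omega>_def by (simp add: not_less)
        hence "Re (V x) \<le> 0" by (rule Vneg[OF x1])
        hence "norm (exp (of_nat N * V x)) \<le> 1" by (simp add: norm_exp_eq_Re mult_nonneg_nonpos)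
        with C(2)[OF x1 xc(2)] have "norm (W x) * norm (exp (of_nat N * V x)) \<le> C * 1"
          using C(1) by (intro mult_mono) auto
        thus ?thesis by (simp only: norm_mult mult_1_right)
      qed
    qed
  qed

  have vanish: "W z = 0" if "z \<in> \<Omega>" "0 < Re (V z)" for z
  proof (rule ccontr)
    assume "W z \<noteq> 0"
    have q: "1 < exp (Re (V z))" using that by simp
    obtain N where N: "C / norm (W z) < exp (Re (V z)) ^ N"
      using real_arch_pow[OF q] by blast
    have "C < exp (Re (V z)) ^ N * norm (W z)"
      using N \<open>W z \<noteq> 0\<close> by (simp add: pos_divide_less_eq)
    also have "\<dots> = norm (W z * exp (of_nat N * V z))"
      by (simp add: norm_mult norm_exp_eq_Re norm_power exp_of_nat_mult)
    finally show False using bound[OF that(1), of N] by simp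
  qed
  define G where "G = \<Omega> \<inter> {z \<in> ball 0 1. 0 < Re (V z)}"
  have "open {z \<in> ball 0 1. 0 < Re (V z)}"
    using continuous_open_preimage[OF continuous_on_Re[OF holomorphic_on_imp_continuous_on[OF Vhol]], of "{0<..}"]
    by (simp add: vimage_def Int_def)
  hence "open G" using \<Omega>open by (auto simp: G_def)
  moreover have "z0 \<in> G" using z0\<Omega> Vz0 nz0 s by (simp add: G_def)
  moreover have "G \<subseteq> ball 0 1" by (auto simp: G_def)
  ultimately show ?thesis
    using analytic_continuation_open[of G "ball 0 1" W "\<lambda>_. 0"] W z vanish
    by (auto simp: G_def)
qed

abbreviation nontangential_filter :: "real \<Rightarrow> complex \<Rightarrow> complex filter" where
  "nontangential_filter M \<zeta> \<equiv> inf (filtercomap norm (at_left 1)) (principal (nontangential_region M \<zeta>))"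

lemma eventually_nontangential_filter:
  "eventually P (nontangential_filter M \<zeta>) \<longleftrightarrow>
     (\<exists>d>0. \<forall>z\<in>nontangential_region M \<zeta>. 1 - d < norm z \<longrightarrow> P z)"
proof -
  have "eventually P (nontangential_filter M \<zeta>) \<longleftrightarrow>
      (\<exists>b<1. \<forall>z. b < norm z \<and> norm z < 1 \<longrightarrow> z \<in> nontangential_region M \<zeta> \<longrightarrow> P z)"
    unfolding eventually_inf_principal eventually_filtercomap eventually_at_left_field
  proof safe
    fix Q b assume "\<forall>x. Q (norm x) \<longrightarrow> x \<in> nontangential_region M \<zeta> \<longrightarrow> P x"
      and "b < 1" "\<forall>y>b. y < 1 \<longrightarrow> Q y"
    thus "\<exists>b<1. \<forall>z. b < norm z \<and> norm z < 1 \<longrightarrow> z \<in> nontangential_region M \<zeta> \<longrightarrow> P z"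
      by (intro exI[of _ b]) simp
  next
    fix b :: real assume "b < 1" "\<forall>z. b < norm z \<and> norm z < 1 \<longrightarrow> z \<in> nontangential_region M \<zeta> \<longrightarrow> P z"
    thus "\<exists>Q. (\<exists>b<1. \<forall>y>b. y < 1 \<longrightarrow> Q y) \<and> (\<forall>x. Q (norm x) \<longrightarrow> x \<in> nontangential_region M \<zeta> \<longrightarrow> P x)"
      by (intro exI[of _ "\<lambda>y. b < y \<and> y < 1"] conjI exI[of _ b]) auto
  qed
  also have "\<dots> \<longleftrightarrow> (\<exists>d>0. \<forall>z\<in>nontangential_region M \<zeta>. 1 - d < norm z \<longrightarrow> P z)"
  proof safe
    fix b :: real assume "b < 1" "\<forall>z. b < norm z \<and> norm z < 1 \<longrightarrow> z \<in> nontangential_region M \<zeta> \<longrightarrow> P z"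
    thus "\<exists>d>0. \<forall>z\<in>nontangential_region M \<zeta>. 1 - d < norm z \<longrightarrow> P z"
      by (intro exI[of _ "1 - b"]) (auto simp: nontangential_region_def)
  next
    fix d :: real assume "0 < d" "\<forall>z\<in>nontangential_region M \<zeta>. 1 - d < norm z \<longrightarrow> P z"
    thus "\<exists>b<1. \<forall>z. b < norm z \<and> norm z < 1 \<longrightarrow> z \<in> nontangential_region M \<zeta> \<longrightarrow> P z"
      by (intro exI[of _ "1 - d"]) auto
  qed
  finally show ?thesis .
qed

text \<open>The aperture may depend on the point. So the set is covered by the countably many sets belonging to the
  apertures \<open>1 + 1/(m+1)\<close>. Each of these is built from closed sets \<open>A \<kappa> j k\<close>, since the cones are open, and Egorov's
  argument leads back to uniform smallness on a compact set.\<close>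

theorem lusin_privalov:
  assumes W: "W holomorphic_on ball 0 1" and nz: "w \<in> ball 0 1" "W w \<noteq> 0"
  shows "negligible {t \<in> {0..<2*pi}. \<exists>M>1. (W \<longlongrightarrow> 0) (nontangential_filter M (cis t))}"
proof -
  define cone where "cone \<kappa> k t = {z. norm z < 1 \<and> 1 - inverse (real (Suc k)) < norm z \<and>
      norm (cis t - z) < (1 + \<kappa>) * (1 - norm z)}" for \<kappa> k t
  define A where "A \<kappa> j k = {t \<in> {0..2*pi}. \<forall>z\<in>cone \<kappa> k t. norm (W z) \<le> inverse (real (Suc j))}" for \<kappa> j k
  have A_closed: "closed (A \<kappa> j k)" for \<kappa> j k
  proof -
    have "A \<kappa> j k = {0..2*pi} \<inter> (\<Inter>z\<in>{z. norm z < 1 \<and> 1 - inverse (real (Suc k)) < norm z \<and>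
        \<not> norm (W z) \<le> inverse (real (Suc j))}. {t. \<not> norm (cis t - z) < (1 + \<kappa>) * (1 - norm z)})"
      unfolding A_def cone_def by blast
    moreover have "closed {t. \<not> norm (cis t - z) < (1 + \<kappa>) * (1 - norm z)}" for z
      unfolding not_less by (intro closed_Collect_le continuous_intros)
    ultimately show ?thesis by (auto intro!: closed_Int closed_INT)
  qed
  have A_mono: "incseq (A \<kappa> j)" for \<kappa> j
  proof (rule incseq_SucI)
    fix k
    have "inverse (real (Suc (Suc k))) \<le> inverse (real (Suc k))"
      by (intro le_imp_inverse_le) auto
    hence "cone \<kappa> (Suc k) t \<subseteq> cone \<kappa> k t" for t
      unfolding cone_def by (intro Collect_mono) linarith
    thus "A \<kappa> j k \<subseteq> A \<kappa> j (Suc k)" unfolding A_def by blast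
  qed
  have E_null: "negligible (\<Inter>j. \<Union>k. A \<kappa> j k)" if \<kappa>: "0 < \<kappa>" "\<kappa> \<le> 1" for \<kappa>
  proof (rule ccontr)
    assume nn: "\<not> negligible (\<Inter>j. \<Union>k. A \<kappa> j k)"
    let ?I = "{0..2*pi} :: real set"
    define M where "M = restrict_space lborel ?I"
    interpret finite_measure M
      unfolding M_def by (intro finite_measureI) (simp add: emeasure_restrict_space space_restrict_space)
    have msr: "B \<in> sets M" "measure M B = measure lebesgue B" if "B \<in> sets borel" "B \<subseteq> ?I" for B
      using that by (auto simp: M_def measure_restrict_space sets_restrict_space_iff)
    have Asub: "A \<kappa> j k \<subseteq> ?I" for j k by (auto simp: A_def)
    have Ab: "A \<kappa> j k \<in> sets borel" for j k using A_closed by (rule borel_closed)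
    have Eb: "(\<Inter>j. \<Union>k. A \<kappa> j k) \<in> sets borel" using Ab by auto
    have Es: "(\<Inter>j. \<Union>k. A \<kappa> j k) \<subseteq> ?I" using Asub by blast
    have "(\<Inter>j. \<Union>k. A \<kappa> j k) \<in> lmeasurable"
      using Eb by (intro bounded_set_imp_lmeasurable[OF bounded_subset[OF bounded_closed_interval Es]]) simp
    hence "0 < measure M (\<Inter>j. \<Union>k. A \<kappa> j k)"
      using nn msr[OF Eb Es] by (simp add: negligible_iff_measure zero_less_measure_iff)
    then obtain k where k: "0 < measure M (\<Inter>j. A \<kappa> j (k j))"
      by (rule egorov_sets[of "A \<kappa>", OF msr(1)[OF Ab Asub] A_mono])
    define T where "T = (\<Inter>j. A \<kappa> j (k j))"
    have Tc: "closed T" using A_closed by (auto simp: T_def)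
    have Ts: "T \<subseteq> ?I" using Asub by (fastforce simp: T_def)
    have "compact T" using Tc Ts bounded_subset[OF bounded_closed_interval Ts] by (simp add: compact_eq_bounded_closed)
    moreover have "\<not> negligible T"
      using k msr(2)[OF borel_closed[OF Tc] Ts] by (simp add: T_def negligible_iff_measure)
    moreover have "\<exists>d>0. \<forall>t\<in>T. \<forall>z. norm z < 1 \<and> 1 - d < norm z \<and>
                   norm (cis t - z) \<le> (1 + \<kappa> / 2) * (1 - norm z) \<longrightarrow> norm (W z) \<le> e" if "0 < e" for e
    proof -
      obtain j where j: "inverse (real (Suc j)) < e" using reals_Archimedean[OF \<open>0 < e\<close>] by blast
      (* Closed cones of aperture 1 + \<kappa>/2 lie inside the open ones of aperture 1 + \<kappa>. *)
      show ?thesis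
      proof (intro exI[of _ "inverse (real (Suc (k j)))"] conjI ballI allI impI)
        fix t z assume t: "t \<in> T" and z: "norm z < 1 \<and> 1 - inverse (real (Suc (k j))) < norm z \<and>
          norm (cis t - z) \<le> (1 + \<kappa> / 2) * (1 - norm z)"
        have "(1 + \<kappa> / 2) * (1 - norm z) < (1 + \<kappa>) * (1 - norm z)"
          using \<kappa> z by (intro mult_strict_right_mono) auto
        hence "norm (cis t - z) < (1 + \<kappa>) * (1 - norm z)" using z by linarith
        hence "z \<in> cone \<kappa> (k j) t" using z unfolding cone_def by blast
        moreover have "t \<in> A \<kappa> j (k j)" using t by (auto simp: T_def)
        ultimately have "norm (W z) \<le> inverse (real (Suc j))" by (simp add: A_def)
        thus "norm (W z) \<le> e" using j by simp
      qed simp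
    qed
    ultimately have "W w = 0"
      using \<kappa> nz by (intro privalov_uniform_smallness[OF W, of T "\<kappa>/2"]) auto
    thus False using nz by simp
  qed
  have "negligible (\<Inter>j. \<Union>k. A (inverse (real (Suc m))) j k)" for m
    by (rule E_null) (simp_all add: inverse_le_1_iff)
  hence "negligible (\<Union>m. \<Inter>j. \<Union>k. A (inverse (real (Suc m))) j k)"
    by (intro negligible_countable_Union) blast+
  thus ?thesis
  proof (rule negligible_subset, safe)
    fix t M assume t: "t \<in> {0..<2*pi}" and M: "1 < M" "(W \<longlongrightarrow> 0) (nontangential_filter M (cis t))"
    obtain m where m: "inverse (real (Suc m)) < M - 1" using reals_Archimedean[of "M - 1"] M by auto
    have "\<exists>k. t \<in> A (inverse (real (Suc m))) j k" for j
    proof -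
      have "eventually (\<lambda>z. norm (W z) < inverse (real (Suc j))) (nontangential_filter M (cis t))"
        using tendstoD[OF M(2), of "inverse (real (Suc j))"] by simp
      then obtain d where d: "0 < d" "\<And>z. z \<in> nontangential_region M (cis t) \<Longrightarrow> 1 - d < norm z \<Longrightarrow>
          norm (W z) < inverse (real (Suc j))"
        by (auto simp: eventually_nontangential_filter)
      obtain k where k: "inverse (real (Suc k)) < d" using reals_Archimedean[OF d(1)] by blast
      have "norm (W z) \<le> inverse (real (Suc j))" if z: "z \<in> cone (inverse (real (Suc m))) k t" for z
      proof -
        have z': "norm z < 1" "1 - inverse (real (Suc k)) < norm z"
            "norm (cis t - z) < (1 + inverse (real (Suc m))) * (1 - norm z)"
          using z by (auto simp: cone_def)
        have "(1 + inverse (real (Suc m))) * (1 - norm z) \<le> M * (1 - norm z)"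
          using m z' by (intro mult_right_mono) auto
        hence "norm (cis t - z) \<le> M * (1 - norm z)" using z'(3) by linarith
        hence "z \<in> nontangential_region M (cis t)" using z' by (simp add: nontangential_region_def)
        thus ?thesis using d(2)[of z] z' k by simp
      qed
      thus ?thesis using t by (auto simp: A_def)
    qed
    hence "t \<in> (\<Inter>j. \<Union>k. A (inverse (real (Suc m))) j k)"
      by (simp only: INT_iff UN_iff bex_UNIV) simp
    thus "t \<in> (\<Union>m. \<Inter>j. \<Union>k. A (inverse (real (Suc m))) j k)"
      by (rule UN_I[OF UNIV_I])
  qed
qed

section \<open>Wronskians of linearly independent functions\<close>

lemma holomorphic_on_det:
  assumes "\<And>i j. i < n \<Longrightarrow> j < n \<Longrightarrow> (\<lambda>z. a i j z) holomorphic_on S"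
  shows "(\<lambda>z. det (mat n n (\<lambda>(i, j). a i j z))) holomorphic_on S"
proof -
  have "det (mat n n (\<lambda>(i, j). a i j z)) =
      (\<Sum>p | p permutes {0..<n}. of_int (sign p) * (\<Prod>i = 0..<n. a i (p i) z))" for z
  proof -
    have "(\<Prod>i = 0..<n. mat n n (\<lambda>(i, j). a i j z) $$ (i, p i)) = (\<Prod>i = 0..<n. a i (p i) z)"
      if "p permutes {0..<n}" for p
      using permutes_in_image[OF that] by (intro prod.cong) auto
    thus ?thesis by (subst det_def'[OF mat_carrier]) (auto intro!: sum.cong)
  qed
  moreover have "(\<lambda>z. \<Sum>p | p permutes {0..<n}. of_int (sign p) * (\<Prod>i = 0..<n. a i (p i) z)) holomorphic_on S"
    by (intro holomorphic_intros) (use assms permutes_in_image in fastforce)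
  ultimately show ?thesis by simp
qed

definition wronskian :: "nat \<Rightarrow> (nat \<Rightarrow> complex \<Rightarrow> complex) \<Rightarrow> complex \<Rightarrow> complex" where
  "wronskian m f z = det (mat m m (\<lambda>(j, k). (deriv ^^ k) (f j) z))"

lemma holomorphic_on_wronskian:
  assumes "open S" "\<And>j. j < m \<Longrightarrow> f j holomorphic_on S"
  shows "wronskian m f holomorphic_on S"
  unfolding wronskian_def using assms
  by (intro holomorphic_on_det holomorphic_higher_deriv) auto

text \<open>By induction, the Wronskian of the first \<open>m\<close> functions is nonzero somewhere, hence on a ball. If
  the next Wronskian vanished identically, its cofactors along the last column, divided by the
  last of them, would give holomorphic \<open>c\<^sub>j\<close> on that ball with \<open>\<Sum> c\<^sub>j f\<^sub>j\<^sup>(\<^sup>k\<^sup>) = 0\<close> for all \<open>k \<le> m\<close> and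
  \<open>c\<^sub>m = 1\<close>. Differentiating these relations for \<open>k < m\<close> leaves \<open>\<Sum> c\<^sub>j' f\<^sub>j\<^sup>(\<^sup>k\<^sup>) = 0\<close>, a homogeneous
  system with nonzero determinant. So the \<open>c\<^sub>j\<close> are constants and the functions are linearly dependent.\<close>

lemma wronskian_not_identically_zero:
  assumes D: "open D" "connected D" "D \<noteq> {}"
    and hol: "\<And>j. j < m \<Longrightarrow> f j holomorphic_on D"
    and indep: "\<And>c :: nat \<Rightarrow> complex. (\<forall>z\<in>D. (\<Sum>j<m. c j * f j z) = 0) \<Longrightarrow> \<forall>j<m. c j = 0"
  shows "\<exists>z\<in>D. wronskian m f z \<noteq> 0"
  using hol indep
proof (induction m)
  case 0
  show ?case using D(3) by (auto simp: wronskian_def)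
next
  case (Suc m)
  have "\<forall>j<m. c j = 0" if "\<forall>z\<in>D. (\<Sum>j<m. c j * f j z) = 0" for c :: "nat \<Rightarrow> complex"
  proof -
    have "\<forall>j<Suc m. (c(m := 0)) j = 0"
      by (rule Suc.prems(2)) (use that in simp)
    thus ?thesis by (metis fun_upd_other less_Suc_eq nat_neq_iff)
  qed
  then obtain z1 where z1: "z1 \<in> D" "wronskian m f z1 \<noteq> 0"
    using Suc.IH Suc.prems(1) by auto
  show ?case
  proof (rule ccontr)
    assume "\<not> ?case"
    hence W0: "wronskian (Suc m) f z = 0" if "z \<in> D" for z using that by blast
    define g where "g j k = (deriv ^^ k) (f j)" for j k
    have ghol: "g j k holomorphic_on D" if "j \<le> m" for j k
      unfolding g_def using Suc.prems(1)[of j] that D(1) by (intro holomorphic_higher_deriv) auto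
    have gder: "(g j k has_field_derivative g j (Suc k) z) (at z)" if "j \<le> m" "z \<in> D" for j k z
      unfolding g_def using has_field_derivative_higher_deriv[of "f j" D z k] Suc.prems(1)[of j] that D(1) by auto
    define A where "A z = mat (Suc m) (Suc m) (\<lambda>(j, k). g j k z)" for z
    have Ac: "A z \<in> carrier_mat (Suc m) (Suc m)" for z by (simp add: A_def)
    define C where "C j z = cofactor (A z) j m" for j z
    have Chol: "C j holomorphic_on D" for j
    proof -
      have "C j = (\<lambda>z. (-1) ^ (j + m) * det (mat m m (\<lambda>(i, k). g (if i < j then i else Suc i) k z)))"
        by (auto simp: C_def cofactor_def mat_delete_def A_def fun_eq_iff
            intro!: arg_cong[of _ _ det] cong_mat)
      moreover have "(\<lambda>z. (-1) ^ (j + m) * det (mat m m (\<lambda>(i, k). g (if i < j then i else Suc i) k z))) holomorphic_on D"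
        by (intro holomorphic_intros holomorphic_on_det ghol) auto
      ultimately show ?thesis by simp
    qed
    have Cm: "C m z = wronskian m f z" for z
      by (auto simp: C_def cofactor_def mat_delete_def A_def wronskian_def g_def
          intro!: arg_cong[of _ _ det] cong_mat)
    have Csum: "(\<Sum>j\<le>m. g j k z * C j z) = 0" if "z \<in> D" "k \<le> m" for k z
    proof -
      (* Expand along the last column the determinant in which that column is replaced by the k-th
         derivatives: it is the Wronskian if k = m, and has two equal columns otherwise. *)
      define B where "B = mat (Suc m) (Suc m) (\<lambda>(j, l). g j (if l = m then k else l) z)"
      have Bc: "B \<in> carrier_mat (Suc m) (Suc m)" by (simp add: B_def)
      have "det B = (\<Sum>j<Suc m. B $$ (j, m) * cofactor B j m)"
        by (rule laplace_expansion_column[OF Bc]) simp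
      moreover have "cofactor B j m = C j z" if "j \<le> m" for j
        using that by (auto simp: C_def cofactor_def mat_delete_def A_def B_def
            intro!: arg_cong[of _ _ det] cong_mat)
      ultimately have "det B = (\<Sum>j\<le>m. g j k z * C j z)"
        by (auto simp: B_def lessThan_Suc_atMost intro!: sum.cong)
      moreover have "det B = 0"
      proof (cases "k = m")
        case True
        hence "B = mat (Suc m) (Suc m) (\<lambda>(j, k). (deriv ^^ k) (f j) z)"
          by (auto simp: B_def g_def intro!: cong_mat)
        thus ?thesis using W0[OF \<open>z \<in> D\<close>] by (simp add: wronskian_def)
      next
        case False
        hence "col B k = col B m" using \<open>k \<le> m\<close> by (auto simp: B_def)
        thus ?thesis using det_identical_columns[OF Bc False] \<open>k \<le> m\<close> by simp
      qed
      ultimately show ?thesis by simp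
    qed
    have "continuous_on D (wronskian m f)"
      using Suc.prems(1) by (intro holomorphic_on_imp_continuous_on holomorphic_on_wronskian D(1)) auto
    then obtain r where r: "0 < r" "ball z1 r \<subseteq> D" "\<And>z. z \<in> ball z1 r \<Longrightarrow> C m z \<noteq> 0"
    proof -
      assume "continuous_on D (wronskian m f)"
      hence "open (D \<inter> wronskian m f -` (- {0}))"
        using D(1) by (intro continuous_open_preimage) auto
      moreover have "z1 \<in> D \<inter> wronskian m f -` (- {0})" using z1 by simp
      ultimately obtain r where "0 < r" "ball z1 r \<subseteq> D \<inter> wronskian m f -` (- {0})"
        by (meson open_contains_ball)
      thus thesis by (intro that[of r]) (auto simp: Cm)
    qed
    define c where "c j z = C j z / C m z" for j z
    have chol: "c j holomorphic_on ball z1 r" for j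
      unfolding c_def using r Chol by (intro holomorphic_intros holomorphic_on_subset[OF Chol]) auto
    have cm: "c m z = 1" if "z \<in> ball z1 r" for z
      using r(3)[OF that] by (simp add: c_def)
    have csum: "(\<Sum>j\<le>m. g j k z * c j z) = 0" if "z \<in> ball z1 r" "k \<le> m" for k z
    proof -
      have "(\<Sum>j\<le>m. g j k z * c j z) = (\<Sum>j\<le>m. g j k z * C j z) / C m z"
        by (simp add: c_def sum_divide_distrib)
      thus ?thesis using Csum[of z k] that r(2) by auto
    qed
    have dc: "deriv (c j) z = 0" if z: "z \<in> ball z1 r" and "j \<le> m" for j z
    proof -
      have cder: "(c j has_field_derivative deriv (c j) z) (at z)" for j
        using holomorphic_derivI[OF chol open_ball z] .
      have dcm: "deriv (c m) z = 0"
      proof -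
        have "(c m has_field_derivative 0) (at z)"
          by (rule has_field_derivative_transform_within_open[of "\<lambda>_. 1" _ _ "ball z1 r"]) (use z cm in auto)
        thus ?thesis by (rule DERIV_imp_deriv)
      qed
      have ker: "(\<Sum>j<m. g j k z * deriv (c j) z) = 0" if "k < m" for k
      proof -
        have "((\<lambda>z. \<Sum>j\<le>m. g j k z * c j z) has_field_derivative
            (\<Sum>j\<le>m. g j k z * deriv (c j) z + g j (Suc k) z * c j z)) (at z)"
          using z r(2) by (intro DERIV_sum DERIV_mult' gder cder) auto
        moreover have "((\<lambda>z. \<Sum>j\<le>m. g j k z * c j z) has_field_derivative 0) (at z)"
          by (rule has_field_derivative_transform_within_open[of "\<lambda>_. 0" _ _ "ball z1 r"]) (use z csum that in auto)
        ultimately have "(\<Sum>j\<le>m. g j k z * deriv (c j) z + g j (Suc k) z * c j z) = 0"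
          by (rule DERIV_unique)
        hence "(\<Sum>j\<le>m. g j k z * deriv (c j) z) = 0"
          using csum[OF z, of "Suc k"] that by (simp add: sum.distrib)
        thus ?thesis using dcm by (simp flip: lessThan_Suc_atMost)
      qed
      define N where "N = mat m m (\<lambda>(k, j). g j k z)"
      have Nc: "N \<in> carrier_mat m m" by (simp add: N_def)
      have "N = transpose_mat (mat m m (\<lambda>(j, k). (deriv ^^ k) (f j) z))"
        by (auto simp: N_def g_def intro!: eq_matI)
      hence "det N = C m z"
        by (simp add: Cm wronskian_def det_transpose[OF mat_carrier])
      hence "det N \<noteq> 0" using r(3)[OF z] by simp
      moreover have "N *\<^sub>v vec m (\<lambda>j. deriv (c j) z) = 0\<^sub>v m"
        using ker by (auto simp: N_def scalar_prod_def lessThan_atLeast0 intro!: eq_vecI)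
      ultimately have "vec m (\<lambda>j. deriv (c j) z) = 0\<^sub>v m"
        using det_0_iff_vec_prod_zero_field[OF Nc] by (metis vec_carrier)
      hence "deriv (c j) z = 0" if "j < m" for j
        using that by (metis index_vec index_zero_vec(1))
      thus ?thesis using dcm \<open>j \<le> m\<close> by (cases "j = m") auto
    qed
    have const: "c j z = c j z1" if "z \<in> ball z1 r" "j \<le> m" for j z
    proof -
      have "(c j has_field_derivative 0) (at w)" if "w \<in> ball z1 r" for w
        using holomorphic_derivI[OF chol open_ball that, of j] dc[OF that \<open>j \<le> m\<close>] by simp
      hence "c j constant_on ball z1 r"
        by (intro has_field_derivative_0_imp_constant_on) auto
      thus ?thesis using that r(1) unfolding constant_on_def by (metis centre_in_ball)
    qed
    have "(\<Sum>j<Suc m. c j z1 * f j z) = 0" if "z \<in> D" for z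
    proof (rule analytic_continuation_open[of "ball z1 r" D "\<lambda>z. \<Sum>j<Suc m. c j z1 * f j z" "\<lambda>_. 0"])
      show "(\<lambda>z. \<Sum>j<Suc m. c j z1 * f j z) holomorphic_on D"
        by (intro holomorphic_intros Suc.prems(1)) auto
      fix z assume z: "z \<in> ball z1 r"
      have "(\<Sum>j<Suc m. c j z1 * f j z) = (\<Sum>j\<le>m. g j 0 z * c j z)"
        using const[OF z] by (auto simp: lessThan_Suc_atMost g_def mult.commute intro!: sum.cong)
      thus "(\<Sum>j<Suc m. c j z1 * f j z) = 0" using csum[OF z, of 0] by simp
    qed (use r D that in auto)
    hence "\<forall>j<Suc m. c j z1 = 0" by (intro Suc.prems(2)) blast
    thus False using cm[of z1] r by auto
  qed
qed

text \<open>Expanded along the changed row, the determinant is linear in that row, and every row other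
  than \<open>i\<close> put in its place gives a determinant with two equal rows.\<close>

lemma det_replace_row_by_combination:
  fixes a :: "nat \<Rightarrow> nat \<Rightarrow> 'a::comm_ring_1"
  assumes i: "i < n"
  shows "det (mat n n (\<lambda>(j, k). if j = i then \<Sum>l<n. c l * a l k else a j k)) =
         c i * det (mat n n (\<lambda>(j, k). a j k))"
proof -
  define R where "R v = mat n n (\<lambda>(j, k). if j = i then v k else a j k)" for v :: "nat \<Rightarrow> 'a"
  have Rc: "R v \<in> carrier_mat n n" for v by (simp add: R_def)
  define K where "K k = cofactor (R (\<lambda>_. 0)) i k" for k
  obtain m where n: "n = Suc m" using i by (cases n) auto
  have det_R: "det (R v) = (\<Sum>k<n. v k * K k)" for v
  proof -
    have "det (R v) = (\<Sum>k<n. R v $$ (i, k) * cofactor (R v) i k)"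
      by (rule laplace_expansion_row[OF Rc i])
    also have "\<dots> = (\<Sum>k<n. v k * K k)"
    proof (intro sum.cong refl arg_cong2[of _ _ _ _ "(*)"])
      fix k assume "k \<in> {..<n}"
      show "R v $$ (i, k) = v k" using i \<open>k \<in> {..<n}\<close> by (simp add: R_def)
      have "mat_delete (R v) i k = mat_delete (R (\<lambda>_. 0)) i k"
        by (rule eq_matI) (auto simp: mat_delete_def R_def n)
      thus "cofactor (R v) i k = K k" by (simp add: K_def cofactor_def)
    qed
    finally show ?thesis .
  qed
  have R_other: "det (R (a l)) = 0" if "l < n" "l \<noteq> i" for l
  proof (rule det_identical_rows[OF Rc])
    show "row (R (a l)) i = row (R (a l)) l"
      using that i by (auto simp: R_def)
  qed (use that i in auto)
  have "det (R (\<lambda>k. \<Sum>l<n. c l * a l k)) = (\<Sum>k<n. \<Sum>l<n. c l * (a l k * K k))"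
    by (simp add: det_R sum_distrib_right mult.assoc)
  also have "\<dots> = (\<Sum>l<n. c l * det (R (a l)))"
    by (subst sum.swap) (simp add: det_R sum_distrib_left)
  also have "\<dots> = c i * det (R (a i))"
    using i R_other by (subst sum.remove[of _ i]) auto
  also have "R (a i) = mat n n (\<lambda>(j, k). a j k)"
    by (auto simp: R_def intro!: cong_mat)
  finally show ?thesis by (simp add: R_def)
qed

lemma higher_deriv_linear_combination:
  fixes f :: "nat \<Rightarrow> complex \<Rightarrow> complex"
  assumes "open S" "z \<in> S" "\<And>l. l < n \<Longrightarrow> f l holomorphic_on S"
  shows "(deriv ^^ k) (\<lambda>w. \<Sum>l<n. c l * f l w) z = (\<Sum>l<n. c l * (deriv ^^ k) (f l) z)"
  using assms(3)
proof (induction n)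
  case 0
  have "(deriv ^^ k) (\<lambda>w. 0 :: complex) = (\<lambda>w. 0)" by (induction k) auto
  thus ?case by simp
next
  case (Suc n)
  have "(deriv ^^ k) (\<lambda>w. (\<Sum>l<n. c l * f l w) + c n * f n w) z =
      (deriv ^^ k) (\<lambda>w. \<Sum>l<n. c l * f l w) z + (deriv ^^ k) (\<lambda>w. c n * f n w) z"
    using Suc.prems assms(1,2) by (intro higher_deriv_add[where S = S] holomorphic_intros) auto
  also have "(deriv ^^ k) (\<lambda>w. c n * f n w) z = c n * (deriv ^^ k) (f n) z"
    using Suc.prems assms(1,2) by (intro higher_deriv_cmult[where A = S]) auto
  finally show ?case using Suc by simp
qed

section \<open>Nontangential decay of the Wronskian\<close>

text \<open>Cauchy's estimate on a disc of radius proportional to \<open>1 - |z|\<close>, on which \<open>1 - |w|\<close> stays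
  comparable to \<open>1 - |z|\<close>. The exponent \<open>a\<close> may have either sign, so \<open>(1 - |w|)\<^sup>a\<close> is bounded by
  the sum of its values at both extremes.\<close>

lemma norm_higher_deriv_le_powr:
  fixes g :: "complex \<Rightarrow> complex"
  assumes hol: "g holomorphic_on ball 0 1" and z: "norm z < 1" and \<theta>: "0 < \<theta>" "\<theta> < 1"
    and B: "0 \<le> B" "\<And>w. norm (w - z) \<le> \<theta> * (1 - norm z) \<Longrightarrow> norm (g w) \<le> B * (1 - norm w) powr a"
  shows "norm ((deriv ^^ k) g z) \<le>
     B * (fact k * ((1 - \<theta>) powr a + (1 + \<theta>) powr a) / \<theta> ^ k) * (1 - norm z) powr (a - real k)"
proof -
  define u where "u = 1 - norm z"
  have u: "0 < u" using z by (simp add: u_def)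
  define K where "K = (1 - \<theta>) powr a + (1 + \<theta>) powr a"
  have sub: "(1 - \<theta>) * u \<le> 1 - norm w \<and> 1 - norm w \<le> (1 + \<theta>) * u" if "norm (w - z) \<le> \<theta> * u" for w
    using that norm_triangle_ineq2[of w z] norm_triangle_ineq3[of w z] by (auto simp: u_def algebra_simps)
  have "cball z (\<theta> * u) \<subseteq> ball 0 1"
  proof
    fix w assume "w \<in> cball z (\<theta> * u)"
    hence "(1 - \<theta>) * u \<le> 1 - norm w" using sub[of w] by (simp add: dist_norm norm_minus_commute)
    moreover have "0 < (1 - \<theta>) * u" using \<theta> u by simp
    ultimately show "w \<in> ball 0 1" by simp
  qed
  hence "g holomorphic_on cball z (\<theta> * u)" using hol holomorphic_on_subset by blast
  hence "norm ((deriv ^^ k) g z) \<le> fact k * (B * (K * u powr a)) / (\<theta> * u) ^ k"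
  proof (intro Cauchy_inequality)
    fix w assume "norm (z - w) = \<theta> * u"
    hence w: "norm (w - z) \<le> \<theta> * u" by (simp add: norm_minus_commute)
    have "0 < (1 - \<theta>) * u" using \<theta> u by simp
    hence nonneg: "0 \<le> 1 - norm w" using sub[OF w] by linarith
    have "(1 - norm w) powr a \<le> ((1 - \<theta>) * u) powr a + ((1 + \<theta>) * u) powr a"
    proof (cases "0 \<le> a")
      case True
      have "(1 - norm w) powr a \<le> ((1 + \<theta>) * u) powr a"
        using sub[OF w] True nonneg by (intro powr_mono2) auto
      thus ?thesis using powr_ge_zero[of "(1 - \<theta>) * u" a] by linarith
    next
      case False
      have "(1 - norm w) powr a \<le> ((1 - \<theta>) * u) powr a"
        using sub[OF w] False \<theta> u by (intro powr_mono2') auto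
      thus ?thesis using powr_ge_zero[of "(1 + \<theta>) * u" a] by linarith
    qed
    also have "\<dots> = K * u powr a" by (simp only: K_def powr_mult distrib_right[of _ _ "u powr a"])
    finally have "B * (1 - norm w) powr a \<le> B * (K * u powr a)"
      using B(1) by (intro mult_left_mono)
    with B(2)[of w] w show "norm (g w) \<le> B * (K * u powr a)" by (simp add: u_def)
  qed (use \<theta> u in \<open>auto intro: holomorphic_on_imp_continuous_on holomorphic_on_subset\<close>)
  also have "\<dots> = B * (fact k * K / \<theta> ^ k) * (u powr a / u ^ k)"
    by (simp add: power_mult_distrib)
  also have "u powr a / u ^ k = u powr (a - real k)"
    using u by (simp add: powr_diff powr_realpow)
  finally show ?thesis by (simp add: K_def u_def)
qed

lemma nontangential_filterI:
  "eventually (\<lambda>z. z \<in> nontangential_region M \<zeta>) (nontangential_filter M \<zeta>)"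
  unfolding eventually_nontangential_filter by (intro exI[of _ 1]) auto

lemma higher_deriv_bigo:
  assumes hol: "g holomorphic_on ball 0 1"
    and bd: "\<And>z. z \<in> ball 0 1 \<Longrightarrow> norm (g z) \<le> B * (1 - norm z) powr a"
  shows "(deriv ^^ k) g \<in> O[nontangential_filter M \<zeta>](\<lambda>z. of_real ((1 - norm z) powr (a - real k)))"
proof (rule bigoI)
  have half: "0 < (1 / 2 :: real)" "1 / 2 < (1 :: real)" by simp_all
  have "0 \<le> B" using order_trans[OF norm_ge_zero bd[of 0]] by simp
  show "eventually (\<lambda>z. norm ((deriv ^^ k) g z) \<le>
      (B * (fact k * ((1 - 1/2) powr a + (1 + 1/2) powr a) / (1/2) ^ k)) *
        norm (of_real ((1 - norm z) powr (a - real k)) :: complex)) (nontangential_filter M \<zeta>)"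
    using nontangential_filterI
  proof eventually_elim
    case (elim z)
    hence z: "norm z < 1" by (simp add: nontangential_region_def)
    have "norm (g w) \<le> B * (1 - norm w) powr a" if "norm (w - z) \<le> 1/2 * (1 - norm z)" for w
    proof (rule bd)
      show "w \<in> ball 0 1" using that z norm_triangle_ineq2[of w z] by simp
    qed
    from norm_higher_deriv_le_powr[OF hol z half \<open>0 \<le> B\<close> this, of k] show ?case
      by (simp only: norm_of_real abs_of_nonneg[OF powr_ge_zero])
  qed
qed

text \<open>The discs in the Cauchy estimate must lie in the larger Stolz region; the radius factor
  \<open>\<theta>\<close> solves \<open>M' + \<theta> = M (1 - \<theta>)\<close>, which is exactly what this requires.\<close>

lemma higher_deriv_nontangential_smallo:
  assumes hol: "g holomorphic_on ball 0 1" and M: "1 < M'" "M' < M" and \<zeta>: "norm \<zeta> = 1"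
    and small: "g \<in> o[nontangential_filter M \<zeta>](\<lambda>z. of_real ((1 - norm z) powr a))"
  shows "(deriv ^^ k) g \<in> o[nontangential_filter M' \<zeta>](\<lambda>z. of_real ((1 - norm z) powr (a - real k)))"
proof (rule landau_o.smallI)
  fix e :: real assume e: "0 < e"
  define \<theta> where "\<theta> = (M - M') / (M + 1)"
  have \<theta>: "0 < \<theta>" "\<theta> < 1" "M' + \<theta> = M * (1 - \<theta>)" using M by (auto simp: \<theta>_def field_simps)
  define K where "K = fact k * ((1 - \<theta>) powr a + (1 + \<theta>) powr a) / \<theta> ^ k"
  have K: "0 < K" unfolding K_def using \<theta> by (intro divide_pos_pos mult_pos_pos add_pos_pos) auto
  define B where "B = e / K"
  have B: "0 < B" using e K by (simp add: B_def)
  obtain d where d: "0 < d" "\<And>w. w \<in> nontangential_region M \<zeta> \<Longrightarrow> 1 - d < norm w \<Longrightarrow>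
      norm (g w) \<le> B * (1 - norm w) powr a"
    using landau_o.smallD[OF small B] by (auto simp: eventually_nontangential_filter)
  show "eventually (\<lambda>z. norm ((deriv ^^ k) g z) \<le> e * norm (of_real ((1 - norm z) powr (a - real k)) :: complex))
      (nontangential_filter M' \<zeta>)"
    unfolding eventually_nontangential_filter
  proof (intro exI[of _ "d/2"] conjI ballI impI)
    fix z assume zr: "z \<in> nontangential_region M' \<zeta>" and zd: "1 - d/2 < norm z"
    have z: "norm z < 1" "norm (\<zeta> - z) \<le> M' * (1 - norm z)"
      using zr by (auto simp: nontangential_region_def)
    have "norm (g w) \<le> B * (1 - norm w) powr a" if w: "norm (w - z) \<le> \<theta> * (1 - norm z)" for w
    proof (rule d(2))
      have lo: "(1 - \<theta>) * (1 - norm z) \<le> 1 - norm w"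
        using w norm_triangle_ineq2[of w z] by (simp add: algebra_simps)
      have "norm (\<zeta> - w) \<le> norm (\<zeta> - z) + norm (w - z)"
        using norm_triangle_ineq4[of "\<zeta> - z" "w - z"] by simp
      also have "\<dots> \<le> (M' + \<theta>) * (1 - norm z)" using z w by (simp add: distrib_right)
      also have "\<dots> = M * ((1 - \<theta>) * (1 - norm z))" by (simp add: \<theta>)
      also have "\<dots> \<le> M * (1 - norm w)" using lo M by (intro mult_left_mono) auto
      finally have "norm (\<zeta> - w) \<le> M * (1 - norm w)" .
      moreover have "0 < (1 - \<theta>) * (1 - norm z)" using \<theta> z by simp
      ultimately show "w \<in> nontangential_region M \<zeta>" using lo by (simp add: nontangential_region_def)
      have "\<theta> * (1 - norm z) \<le> 1 * (1 - norm z)" using \<theta> z by (intro mult_right_mono) auto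
      hence "norm (w - z) \<le> 1 - norm z" using w by simp
      thus "1 - d < norm w" using zd norm_triangle_ineq3[of w z] by linarith
    qed
    from norm_higher_deriv_le_powr[OF hol z(1) \<theta>(1,2) less_imp_le[OF B] this, of k]
    have "norm ((deriv ^^ k) g z) \<le> B * K * (1 - norm z) powr (a - real k)"
      by (simp add: K_def)
    thus "norm ((deriv ^^ k) g z) \<le> e * norm (of_real ((1 - norm z) powr (a - real k)) :: complex)"
      using K by (simp add: B_def)
  qed (use d in auto)
qed

text \<open>In the term of a permutation \<open>p\<close>, the row of \<open>g\<close> contributes the exponent \<open>\<gamma> - p i\<close> with a
  little-o, and each other row \<open>j\<close> contributes \<open>-\<beta> - p j\<close> with a big-O. The exponents always add up to \<open>0\<close>.\<close>

lemma wronskian_tendsto_0: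
  fixes f :: "nat \<Rightarrow> complex \<Rightarrow> complex" and \<beta> :: real
  assumes hol: "\<And>j. j \<le> n \<Longrightarrow> f j holomorphic_on ball 0 1"
    and bd: "\<And>j. j \<le> n \<Longrightarrow> \<exists>B. \<forall>z\<in>ball 0 1. norm (f j z) \<le> B * (1 - norm z) powr (-\<beta>)"
    and \<zeta>: "norm \<zeta> = 1" and i: "i \<le> n" "c i \<noteq> 0"
    and M: "1 < M'" "M' < M"
    and small: "(\<lambda>z. \<Sum>j\<le>n. c j * f j z) \<in> o[nontangential_filter M \<zeta>](\<lambda>z. of_real ((1 - norm z) powr (real n * \<beta> + real n * (real n + 1) / 2)))"
  shows "(wronskian (Suc n) f \<longlongrightarrow> 0) (nontangential_filter M' \<zeta>)"
proof -
  let ?F = "nontangential_filter M' \<zeta>"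
  define \<gamma> where "\<gamma> = real n * \<beta> + real n * (real n + 1) / 2"
  define g where "g z = (\<Sum>j<Suc n. c j * f j z)" for z
  have g_hol: "g holomorphic_on ball 0 1"
    unfolding g_def by (intro holomorphic_intros hol) auto
  define e where "e j k = (if j = i then \<gamma> else -\<beta>) - real k" for j k :: nat
  define h where "h j k = (deriv ^^ k) (if j = i then g else f j)" for j k
  have h_small: "h i k \<in> o[?F](\<lambda>z. of_real ((1 - norm z) powr e i k))" for k
    using higher_deriv_nontangential_smallo[OF g_hol M \<zeta>, of \<gamma> k] small
    by (simp add: h_def e_def g_def[abs_def] \<gamma>_def lessThan_Suc_atMost)
  have h_big: "h j k \<in> O[?F](\<lambda>z. of_real ((1 - norm z) powr e j k))" if j: "j \<le> n" "j \<noteq> i" for j k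
  proof -
    obtain B where "\<And>z. z \<in> ball 0 1 \<Longrightarrow> norm (f j z) \<le> B * (1 - norm z) powr (-\<beta>)"
      using bd[OF j(1)] by blast
    from higher_deriv_bigo[OF hol[OF j(1)] this] show ?thesis
      using j by (simp add: h_def e_def)
  qed
  have W: "c i * wronskian (Suc n) f z =
      (\<Sum>p | p permutes {0..<Suc n}. of_int (sign p) * (\<Prod>j = 0..<Suc n. h j (p j) z))"
    if z: "z \<in> ball 0 1" for z
  proof -
    define D where "D = mat (Suc n) (Suc n) (\<lambda>(j, k). h j k z)"
    have "D = mat (Suc n) (Suc n) (\<lambda>(j, k). if j = i then \<Sum>l<Suc n. c l * (deriv ^^ k) (f l) z
        else (deriv ^^ k) (f j) z)"
      unfolding D_def h_def g_def[abs_def]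
      using higher_deriv_linear_combination[OF open_ball z, of "Suc n" f] hol
      by (intro cong_mat) auto
    hence "det D = c i * wronskian (Suc n) f z"
      using det_replace_row_by_combination[of i "Suc n" c "\<lambda>j k. (deriv ^^ k) (f j) z"] i(1)
      by (simp add: wronskian_def)
    moreover have "det D = (\<Sum>p | p permutes {0..<Suc n}. of_int (sign p) * (\<Prod>j = 0..<Suc n. h j (p j) z))"
    proof -
      have "(\<Prod>j = 0..<Suc n. D $$ (j, p j)) = (\<Prod>j = 0..<Suc n. h j (p j) z)"
        if "p permutes {0..<Suc n}" for p
        using permutes_in_image[OF that] by (intro prod.cong) (auto simp: D_def)
      thus ?thesis by (subst det_def'[of _ "Suc n"]) (auto simp: D_def intro!: sum.cong)
    qed
    ultimately show ?thesis by simp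
  qed
  have term_small: "(\<lambda>z. of_int (sign p) * (\<Prod>j = 0..<Suc n. h j (p j) z)) \<in> o[?F](\<lambda>_. 1)"
    if p: "p permutes {0..<Suc n}" for p
  proof -
    let ?I = "{0..<Suc n}"
    have "(\<lambda>z. h i (p i) z * (\<Prod>j\<in>?I - {i}. h j (p j) z)) \<in>
        o[?F](\<lambda>z. of_real ((1 - norm z) powr e i (p i)) * (\<Prod>j\<in>?I - {i}. of_real ((1 - norm z) powr e j (p j))))"
      by (intro landau_o.small_big_mult h_small landau_o.big_prod h_big) auto
    also have "(\<lambda>z. h i (p i) z * (\<Prod>j\<in>?I - {i}. h j (p j) z)) = (\<lambda>z. \<Prod>j\<in>?I. h j (p j) z)"
      using i(1) by (intro ext, subst prod.remove[of ?I i]) auto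
    also have "o[?F](\<lambda>z. of_real ((1 - norm z) powr e i (p i)) * (\<Prod>j\<in>?I - {i}. of_real ((1 - norm z) powr e j (p j)))) =
        o[?F](\<lambda>_. 1 :: complex)"
    proof (rule landau_o.small.cong)
      have "(\<Sum>j\<in>?I. e j (p j)) = 0"
      proof -
        have "(\<Sum>j\<in>?I. e j (p j)) = (\<Sum>j\<in>?I. if j = i then \<gamma> else -\<beta>) - (\<Sum>j\<in>?I. real (p j))"
          by (simp add: e_def sum_subtractf)
        also have "(\<Sum>j\<in>?I. real (p j)) = (\<Sum>j\<in>?I. real j)"
          using sum.permute[OF p, of real] by (simp add: o_def)
        also have "\<dots> = real n * (real n + 1) / 2"
          by (induction n) (auto simp: field_simps)
        also have "(\<Sum>j\<in>?I. if j = i then \<gamma> else -\<beta>) = \<gamma> - real n * \<beta>"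
          using i(1) by (subst sum.remove[of _ i]) auto
        finally show ?thesis by (simp add: \<gamma>_def)
      qed
      show "eventually (\<lambda>z. of_real ((1 - norm z) powr e i (p i)) *
          (\<Prod>j\<in>?I - {i}. of_real ((1 - norm z) powr e j (p j))) = (1 :: complex)) ?F"
        using nontangential_filterI
      proof eventually_elim
        case (elim z)
        hence u: "0 < 1 - norm z" by (simp add: nontangential_region_def)
        have "of_real ((1 - norm z) powr e i (p i)) * (\<Prod>j\<in>?I - {i}. of_real ((1 - norm z) powr e j (p j))) =
            (of_real (\<Prod>j\<in>?I. (1 - norm z) powr e j (p j)) :: complex)"
          using i(1) by (subst prod.remove[of ?I i]) auto
        also have "(\<Prod>j\<in>?I. (1 - norm z) powr e j (p j)) = (1 - norm z) powr (\<Sum>j\<in>?I. e j (p j))"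
          using u by (subst powr_sum) auto
        finally show ?case using u \<open>(\<Sum>j\<in>?I. e j (p j)) = 0\<close> by simp
      qed
    qed
    finally have "(\<lambda>z. \<Prod>j\<in>?I. h j (p j) z) \<in> o[?F](\<lambda>_. 1)" .
    thus ?thesis by (simp add: sign_def)
  qed
  have "(\<lambda>z. \<Sum>p | p permutes {0..<Suc n}. of_int (sign p) * (\<Prod>j = 0..<Suc n. h j (p j) z)) \<in> o[?F](\<lambda>_. 1)"
    using term_small by (intro big_sum_in_smallo) auto
  hence "((\<lambda>z. \<Sum>p | p permutes {0..<Suc n}. of_int (sign p) * (\<Prod>j = 0..<Suc n. h j (p j) z)) \<longlongrightarrow> 0) ?F"
    using smalloD_tendsto by fastforce
  hence "((\<lambda>z. c i * wronskian (Suc n) f z) \<longlongrightarrow> 0) ?F"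
  proof (rule Lim_transform_eventually)
    show "eventually (\<lambda>z. (\<Sum>p | p permutes {0..<Suc n}. of_int (sign p) * (\<Prod>j = 0..<Suc n. h j (p j) z)) =
        c i * wronskian (Suc n) f z) ?F"
      using nontangential_filterI
      by eventually_elim (use W in \<open>auto simp: nontangential_region_def\<close>)
  qed
  thus ?thesis using i(2) tendsto_mult_left_iff[of "c i" "wronskian (Suc n) f" 0 ?F] by simp
qed

section \<open>The exceptional set\<close>

text \<open>Both growth spaces at once: \<open>\<beta> = 0\<close> is the bounded case.\<close>

lemma small_set_null:
  assumes hol: "\<And>j. j \<le> n \<Longrightarrow> f j holomorphic_on ball 0 1"
    and bd: "\<And>j. j \<le> n \<Longrightarrow> \<exists>B. \<forall>z\<in>ball 0 1. norm (f j z) \<le> B * (1 - norm z) powr (-\<beta>)"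
    and indep: "lin_indep_on_disc n f"
  shows "small_set (real n * \<beta> + real n * (real n + 1) / 2) n f \<in> null_sets circle_lebesgue"
proof -
  let ?E = "small_set (real n * \<beta> + real n * (real n + 1) / 2) n f"
  have Whol: "wronskian (Suc n) f holomorphic_on ball 0 1"
    using hol by (intro holomorphic_on_wronskian) auto
  have "\<exists>w\<in>ball 0 1. wronskian (Suc n) f w \<noteq> 0"
    using indep hol unfolding lin_indep_on_disc_def
    by (intro wronskian_not_identically_zero) (auto simp: lessThan_Suc_atMost less_Suc_eq_le)
  then obtain w where w: "w \<in> ball 0 1" "wronskian (Suc n) f w \<noteq> 0" by blast
  have sub: "\<exists>M>1. (wronskian (Suc n) f \<longlongrightarrow> 0) (nontangential_filter M \<zeta>)" if "\<zeta> \<in> ?E" for \<zeta>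
  proof -
    from that obtain c i M where \<zeta>: "norm \<zeta> = 1" and i: "i \<le> n" "c i \<noteq> 0" and M: "1 < M"
      and small: "(\<lambda>z. \<Sum>j\<le>n. c j * f j z) \<in> o[nontangential_filter M \<zeta>](\<lambda>z. of_real ((1 - norm z) powr (real n * \<beta> + real n * (real n + 1) / 2)))"
      by (auto simp: small_set_def nontangentially_small_def Let_def)
    obtain M' where "1 < M'" "M' < M" using dense[OF M] by blast
    thus ?thesis
      using wronskian_tendsto_0[OF hol bd \<zeta> i _ _ small] by blast
  qed
  have "?E \<subseteq> unit_circle" by (auto simp: small_set_def)
  moreover have "negligible {t \<in> {0..<2*pi}. cis t \<in> ?E}"
    by (rule negligible_subset[OF lusin_privalov[OF Whol w]]) (use sub in auto)
  ultimately show ?thesis by (simp only: null_sets_circle_lebesgue_iff)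
qed

theorem theorem2p1:
  fixes n :: nat
  assumes "n \<ge> 1"
  shows "(\<forall>\<beta>::real. \<forall>f :: nat \<Rightarrow> complex \<Rightarrow> complex.
            \<beta> > 0 \<longrightarrow> (\<forall>j\<le>n. f j \<in> growth_space \<beta>) \<longrightarrow> lin_indep_on_disc n f \<longrightarrow>
            small_set (real n * \<beta> + real n * (real n + 1) / 2) n f \<in> null_sets circle_lebesgue) \<and>
         (\<forall>f :: nat \<Rightarrow> complex \<Rightarrow> complex.
            (\<forall>j\<le>n. f j \<in> H_infinity) \<longrightarrow> lin_indep_on_disc n f \<longrightarrow>
            small_set (real n * (real n + 1) / 2) n f \<in> null_sets circle_lebesgue)"
proof (intro conjI allI impI)
  fix \<beta> :: real and f :: "nat \<Rightarrow> complex \<Rightarrow> complex"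
  assume "\<forall>j\<le>n. f j \<in> growth_space \<beta>" and indep: "lin_indep_on_disc n f"
  hence f: "f j \<in> growth_space \<beta>" if "j \<le> n" for j using that by blast
  show "small_set (real n * \<beta> + real n * (real n + 1) / 2) n f \<in> null_sets circle_lebesgue"
  proof (rule small_set_null[OF _ _ indep])
    fix j assume j: "j \<le> n"
    show "f j holomorphic_on ball 0 1" using f[OF j] by (simp add: growth_space_def)
    obtain B where B: "\<And>z. z \<in> ball 0 1 \<Longrightarrow> norm (f j z) * (1 - norm z) powr \<beta> \<le> B"
      using f[OF j] by (fastforce simp: growth_space_def bdd_above_def)
    show "\<exists>B. \<forall>z\<in>ball 0 1. norm (f j z) \<le> B * (1 - norm z) powr (-\<beta>)"
    proof (intro exI ballI)
      fix z :: complex assume z: "z \<in> ball 0 1"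
      hence "0 < (1 - norm z) powr \<beta>" by simp
      thus "norm (f j z) \<le> B * (1 - norm z) powr (-\<beta>)"
        using B[OF z] by (simp add: powr_minus field_simps)
    qed
  qed
next
  fix f :: "nat \<Rightarrow> complex \<Rightarrow> complex"
  assume "\<forall>j\<le>n. f j \<in> H_infinity" and indep: "lin_indep_on_disc n f"
  hence f: "f j \<in> H_infinity" if "j \<le> n" for j using that by blast
  (* Boundedness is the growth condition with exponent 0. *)
  have "small_set (real n * 0 + real n * (real n + 1) / 2) n f \<in> null_sets circle_lebesgue"
  proof (rule small_set_null[OF _ _ indep])
    fix j assume j: "j \<le> n"
    show "f j holomorphic_on ball 0 1" using f[OF j] by (simp add: H_infinity_def)
    obtain B where "\<And>z. z \<in> ball 0 1 \<Longrightarrow> norm (f j z) \<le> B"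
      using f[OF j] by (fastforce simp: H_infinity_def bounded_iff)
    thus "\<exists>B. \<forall>z\<in>ball 0 1. norm (f j z) \<le> B * (1 - norm z) powr (-0)"
      by (intro exI[of _ B]) (auto simp: powr_zero_eq_one)
  qed
  thus "small_set (real n * (real n + 1) / 2) n f \<in> null_sets circle_lebesgue" by simp
qed

end
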